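(* Let $w=(w_k)_{k\ge0}$ be a weight sequence with $w_0>0$, $w_k>0$ for all large $k$, and $w_{k+1}/w_k\to0$ as $k\to\infty$. Suppose that $n\to\infty$ and $m=m(n)$ with $m=\lambda n+o(\sqrt n)$, where $0<\lambda<\infty$. Let $\tau>0$ satisfy $\Psi(\tau)=\lambda$, let $\pi_k=\tau^kw_k/\Phi(\tau)$ and $n_k=\lfloor1/\pi_k\rfloor$. (i) Consider $n$ in a subsequence such that for some $k(n)$ and some $x\in(0,\infty)$, $n/n_{k(n)}\to x$. Then $P(Y_{(1)}=k(n)-1)\to e^{-x}$ and $P(Y_{(1)}=k(n))\to1-e^{-x}$. (ii) Let $\Omega_k\to\infty$ as $k\to\infty$. If $n\to\infty$ with $n\notin\bigcup_{k\ge1}[\Omega_k^{-1}n_k,\Omega_kn_k]$, then, for $k(n)$ such that $n_{k(n)}<n<n_{k(n)+1}$, $P(Y_{(1)}=k(n))\to1$.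
   Context: A weight sequence is a sequence $w=(w_k)_{k\ge0}$ of nonnegative reals. $\Phi(t)=\sum_kw_kt^k$ (here entire), $\Psi(t)=t\Phi'(t)/\Phi(t)$. Balls-in-boxes: $\mathcal B_{m,n}=\{(y_1,\dots,y_n)\in\{0,1,\dots\}^n:\sum y_i=m\}$, weight $w(y)=\prod_iw_{y_i}$, $Z(m,n)=\sum_{y\in\mathcal B_{m,n}}w(y)$; when $Z(m,n)>0$, $B_{m,n}=(Y_1,\dots,Y_n)$ is random with $P(B_{m,n}=y)=w(y)/Z(m,n)$. $Y_{(1)}=\max_iY_i$. *)

theory Defs
  imports "HOL-Analysis.Analysis"
begin

definition Phi :: "(nat \<Rightarrow> real) \<Rightarrow> real \<Rightarrow> real" where
  "Phi w t = (\<Sum>k. w k * t ^ k)"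

definition Psi :: "(nat \<Rightarrow> real) \<Rightarrow> real \<Rightarrow> real" where
  "Psi w t = t * deriv (Phi w) t / Phi w t"

text \<open>Balls-in-boxes configurations: y indexed by boxes 0..n-1.\<close>
definition Bset :: "nat \<Rightarrow> nat \<Rightarrow> (nat \<Rightarrow> nat) set" where
  "Bset m n = {y \<in> PiE {..<n} (\<lambda>_. {..m}). (\<Sum>i<n. y i) = m}"

definition wt :: "(nat \<Rightarrow> real) \<Rightarrow> nat \<Rightarrow> (nat \<Rightarrow> nat) \<Rightarrow> real" where
  "wt w n y = (\<Prod>i<n. w (y i))"

definition Zbb :: "(nat \<Rightarrow> real) \<Rightarrow> nat \<Rightarrow> nat \<Rightarrow> real" where
  "Zbb w m n = (\<Sum>y\<in>Bset m n. wt w n y)"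

definition Pmax :: "(nat \<Rightarrow> real) \<Rightarrow> nat \<Rightarrow> nat \<Rightarrow> nat \<Rightarrow> real" where
  "Pmax w m n k = (\<Sum>y\<in>{y \<in> Bset m n. Max (y ` {..<n}) = k}. wt w n y) / Zbb w m n"

end

theory Submission
  imports Defs "HOL-Probability.Characteristic_Functions" "HOL-Probability.Distributions"
begin

text \<open>
  Tilting the weights to the probabilities \<open>p\<^sub>k = \<tau>\<^sup>k w\<^sub>k / \<Phi>(\<tau>)\<close>, of mean \<open>\<lambda>\<close>, leaves the law of the
  boxes unchanged, so \<open>P(Y\<^sub>(\<^sub>1\<^sub>) \<le> k) = Q\<^sub>k / Q\<^sub>m\<close>, where \<open>Q\<^sub>k\<close> is the probability that \<open>n\<close> independent
  \<open>p\<close>-distributed variables sum to \<open>m\<close> and are all at most \<open>k\<close>. By Fourier inversion \<open>Q\<^sub>k\<close> is an integral of the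
  \<open>n\<close>-th power of the truncated characteristic function. With the tail \<open>T(k) = p\<^sub>k\<^sub>+\<^sub>1 + p\<^sub>k\<^sub>+\<^sub>2 + \<dots>\<close>, dominated
  convergence gives \<open>\<surd>n Q\<^sub>k \<rightarrow> e\<^sup>-\<^sup>y / \<surd>(2\<pi>\<sigma>\<^sup>2)\<close> whenever \<open>k \<rightarrow> \<infinity>\<close> and \<open>n T(k) \<rightarrow> y\<close>, and \<open>\<surd>n Q\<^sub>k \<rightarrow> 0\<close>
  when \<open>n T(k) \<rightarrow> \<infinity>\<close>; moreover \<open>n T(m) \<rightarrow> 0\<close>. Hence \<open>P(Y\<^sub>(\<^sub>1\<^sub>) \<le> k)\<close> tends to \<open>e\<^sup>-\<^sup>y\<close>, respectively to \<open>0\<close>. Both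
  parts follow since \<open>p\<^sub>k\<^sub>+\<^sub>1 / p\<^sub>k \<rightarrow> 0\<close> makes \<open>T(k-1)\<close> asymptotic to \<open>p\<^sub>k\<close>.
\<close>

section \<open>Fourier inversion\<close>

text \<open>The cap \<open>k\<close> is kept separate from the total \<open>m\<close>, so that the
  distribution function of the largest box is a quotient of two values: cap \<open>k\<close> over
  cap \<open>m\<close>.\<close>

definition box_sum :: "(nat \<Rightarrow> real) \<Rightarrow> nat \<Rightarrow> nat \<Rightarrow> nat \<Rightarrow> real" where
  "box_sum w k n m = (\<Sum>y \<in> {y \<in> PiE {..<n} (\<lambda>_. {..k}). (\<Sum>i<n. y i) = m}. \<Prod>i<n. w (y i))"

text \<open>The truncated law is not renormalised: its missing mass \<open>tail p k\<close> is what
  produces the factor exp(-y) in the limit.\<close>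

definition trunc_char :: "(nat \<Rightarrow> real) \<Rightarrow> nat \<Rightarrow> real \<Rightarrow> complex" where
  "trunc_char p k t = (\<Sum>j\<le>k. of_real (p j) * cis (real j * t))"

text \<open>Orthogonality of characters over one period. The frequency is an integer because it will
  be a difference of two totals.\<close>

lemma has_bochner_integral_cis:
  fixes d :: int
  shows "has_bochner_integral lborel
    (\<lambda>t. indicator {- pi..pi} t *\<^sub>R cis (real_of_int d * t)) (of_real (if d = 0 then 2 * pi else 0))"
proof (cases "d = 0")
  case True
  have "has_bochner_integral lborel (\<lambda>t. indicator {- pi..pi} t *\<^sub>R (1::complex))
     (of_real pi - of_real (- pi))"
    by (rule has_bochner_integral_FTC_Icc)
       (auto intro!: derivative_eq_intros continuous_intros)
  then show ?thesis using True by simp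
next
  case False
  define F where "F = (\<lambda>t. cis (real_of_int d * t) / (\<i> * of_int d))"
  have "has_bochner_integral lborel (\<lambda>t. indicator {- pi..pi} t *\<^sub>R cis (real_of_int d * t)) (F pi - F (- pi))"
  proof (rule has_bochner_integral_FTC_Icc)
    fix x assume "- pi \<le> x" "x \<le> pi"
    show "(F has_vector_derivative cis (real_of_int d * x)) (at x within {- pi..pi})"
      unfolding F_def cis_conv_exp using False
      by (auto intro!: derivative_eq_intros has_vector_derivative_real_field simp: field_simps)
  qed (auto intro!: continuous_intros)
  moreover have "F pi = F (- pi)"
    unfolding F_def
    by (simp add: cis.ctr sin_times_pi_eq_0 mult.commute[of _ pi])
  ultimately show ?thesis using False by simp
qed

lemma trunc_char_power:
  "trunc_char p k t ^ n =
     (\<Sum>y\<in>PiE {..<n} (\<lambda>_. {..k}). of_real (\<Prod>i<n. p (y i)) * cis (real (\<Sum>i<n. y i) * t))"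
proof -
  have "trunc_char p k t ^ n = (\<Prod>i<n. \<Sum>j\<le>k. of_real (p j) * cis (real j * t))"
    by (simp add: trunc_char_def)
  also have "\<dots> = (\<Sum>y\<in>PiE {..<n} (\<lambda>_. {..k}). \<Prod>i<n. of_real (p (y i)) * cis (real (y i) * t))"
    by (subst prod_sum_PiE) auto
  also have "\<dots> = (\<Sum>y\<in>PiE {..<n} (\<lambda>_. {..k}). of_real (\<Prod>i<n. p (y i)) * cis (real (\<Sum>i<n. y i) * t))"
  proof (rule sum.cong[OF refl])
    fix y :: "nat \<Rightarrow> nat"
    have "(\<Prod>i<n. cis (real (y i) * t)) = cis (real (\<Sum>i<n. y i) * t)"
      by (induction n) (auto simp: cis_mult algebra_simps)
    then show "(\<Prod>i<n. of_real (p (y i)) * cis (real (y i) * t)) =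
      of_real (\<Prod>i<n. p (y i)) * cis (real (\<Sum>i<n. y i) * t)"
      by (simp add: prod.distrib)
  qed
  finally show ?thesis .
qed

text \<open>Once the power is expanded over configurations, orthogonality keeps exactly those of
  total \<open>m\<close>, each contributing 2 pi times its weight.\<close>

lemma box_sum_fourier:
  "has_bochner_integral lborel
     (\<lambda>t. indicator {- pi..pi} t *\<^sub>R (trunc_char p k t ^ n * cis (- real m * t)))
     (of_real (2 * pi * box_sum p k n m))"
proof -
  let ?P = "PiE {..<n} (\<lambda>_. {..k})"
  have fin: "finite ?P" by (intro finite_PiE) auto
  have "has_bochner_integral lborel
     (\<lambda>t. \<Sum>y\<in>?P. of_real (\<Prod>i<n. p (y i)) *
        (indicator {- pi..pi} t *\<^sub>R cis (real_of_int (int (\<Sum>i<n. y i) - int m) * t)))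
     (\<Sum>y\<in>?P. complex_of_real (\<Prod>i<n. p (y i)) * complex_of_real (if int (\<Sum>i<n. y i) - int m = 0 then 2 * pi else 0))"
    by (intro has_bochner_integral_sum has_bochner_integral_mult_right has_bochner_integral_cis)
  moreover have "(\<lambda>t. \<Sum>y\<in>?P. of_real (\<Prod>i<n. p (y i)) *
        (indicator {- pi..pi} t *\<^sub>R cis (real_of_int (int (\<Sum>i<n. y i) - int m) * t)))
     = (\<lambda>t. indicator {- pi..pi} t *\<^sub>R (trunc_char p k t ^ n * cis (- real m * t)))"
    unfolding trunc_char_power sum_distrib_right scaleR_sum_right
    by (intro ext sum.cong) (auto simp: mult.assoc cis_mult algebra_simps)
  moreover have "(\<Sum>y\<in>?P. complex_of_real (\<Prod>i<n. p (y i)) * complex_of_real (if int (\<Sum>i<n. y i) - int m = 0 then 2 * pi else 0))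
     = complex_of_real (2 * pi * box_sum p k n m)"
  proof -
    have "(\<Sum>y\<in>?P. complex_of_real (\<Prod>i<n. p (y i)) * complex_of_real (if int (\<Sum>i<n. y i) - int m = 0 then 2 * pi else 0))
      = complex_of_real (\<Sum>y\<in>?P. if (\<Sum>i<n. y i) = m then 2 * pi * (\<Prod>i<n. p (y i)) else 0)"
      unfolding of_real_sum by (intro sum.cong) (auto simp del: of_nat_sum)
    also have "(\<Sum>y\<in>?P. if (\<Sum>i<n. y i) = m then 2 * pi * (\<Prod>i<n. p (y i)) else 0) = 2 * pi * box_sum p k n m"
      unfolding box_sum_def using fin
      by (simp add: sum.inter_filter[symmetric] sum_distrib_left)
    finally show ?thesis .
  qed
  ultimately show ?thesis by simp
qed

text \<open>The substitution t = u / sqrt n matches the fluctuations of the sum, which are of order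
  sqrt n, and gives the integrand a pointwise limit.\<close>

lemma box_sum_fourier_scaled:
  assumes "n > 0"
  shows "of_real (2 * pi * (sqrt n * box_sum p k n m)) =
    (LINT u|lborel. indicator {- pi * sqrt n..pi * sqrt n} u *\<^sub>R
       (trunc_char p k (u / sqrt n) ^ n * cis (- real m * (u / sqrt n))))"
proof -
  let ?f = "\<lambda>t. indicator {- pi..pi} t *\<^sub>R (trunc_char p k t ^ n * cis (- real m * t))"
  have s: "sqrt n > 0" using assms by simp
  have "of_real (2 * pi * box_sum p k n m) = (LINT t|lborel. ?f t)"
    using box_sum_fourier[of p k n m] by (simp add: has_bochner_integral_iff)
  also have "\<dots> = (1 / sqrt n) *\<^sub>R (LINT u|lborel. ?f (0 + (1 / sqrt n) * u))"
    by (subst lborel_integral_real_affine[where c = "1 / sqrt n" and t = 0]) (use s in auto)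
  also have "(\<lambda>u. ?f (0 + (1 / sqrt n) * u)) = (\<lambda>u. indicator {- pi * sqrt n..pi * sqrt n} u *\<^sub>R
       (trunc_char p k (u / sqrt n) ^ n * cis (- real m * (u / sqrt n))))"
    using s by (intro ext) (auto simp: indicator_def field_simps)
  finally have "sqrt n *\<^sub>R of_real (2 * pi * box_sum p k n m) = (LINT u|lborel. indicator {- pi * sqrt n..pi * sqrt n} u *\<^sub>R
       (trunc_char p k (u / sqrt n) ^ n * cis (- real m * (u / sqrt n))))"
    using s by simp
  then show ?thesis by (simp add: scaleR_conv_of_real mult_ac)
qed

section \<open>Elementary bounds for cosines and the Gaussian integral\<close>

text \<open>At y = x/2 one has |y| <= 2, so the Taylor bound gives 1 - cos y >= y^2/2 - y^2/6 =
  x^2/12. The double-angle formula and cos y >= 0 carry this over to x.\<close>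

lemma one_minus_cos_ge:
  fixes x :: real
  assumes "\<bar>x\<bar> \<le> pi"
  shows "x\<^sup>2 / 12 \<le> 1 - cos x"
proof -
  have quartic: "y\<^sup>2 / 2 - y ^ 4 / 24 \<le> 1 - cos y" for y :: real
  proof -
    have "\<bar>Re (exp (\<i> * y) - (\<Sum>k\<le>3. (\<i> * y) ^ k / fact k))\<bar> \<le> \<bar>y\<bar> ^ 4 / fact 4"
      using order_trans[OF abs_Re_le_cmod iexp_approx1[of y 3]] by simp
    moreover have "Re (exp (\<i> * y) - (\<Sum>k\<le>3. (\<i> * y) ^ k / fact k)) = cos y - 1 + y\<^sup>2 / 2"
      by (simp add: numeral_3_eq_3 fact_numeral Re_exp power2_eq_square)
    ultimately have "\<bar>cos y - 1 + y\<^sup>2 / 2\<bar> \<le> y ^ 4 / 24" by (simp only:) (simp add: fact_numeral)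
    then show ?thesis by linarith
  qed
  have "(x/2)\<^sup>2 \<le> 2\<^sup>2"
    using assms pi_less_4 by (intro abs_le_square_iff[THEN iffD1]) auto
  then have "(x/2) ^ 4 \<le> 4 * (x/2)\<^sup>2"
    using mult_right_mono[of "(x/2)\<^sup>2" 4 "(x/2)\<^sup>2"] by (simp add: power2_eq_square power4_eq_xxxx)
  then have A: "x\<^sup>2 / 12 \<le> 1 - cos (x/2)"
    using quartic[of "x/2"] by (simp add: power2_eq_square)
  have c: "cos (x/2) \<ge> 0" using assms by (intro cos_ge_zero) auto
  have "cos x = 2 * (cos (x/2))\<^sup>2 - 1" using cos_double_cos[of "x/2"] by simp
  then have "1 - cos x = 2 * (1 - cos (x/2)) * (1 + cos (x/2))" by (simp add: power2_eq_square algebra_simps)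
  also have "\<dots> \<ge> 2 * (1 - cos (x/2)) * 1"
    using c by (intro mult_left_mono) auto
  finally have "1 - cos x \<ge> 2 * (1 - cos (x/2))" by simp
  moreover have "1 - cos (x/2) \<le> 2 * (1 - cos (x/2))" by simp
  ultimately show ?thesis using A by (meson order_trans)
qed

text \<open>Factoring out the unimodular \<open>cis s\<close> leaves the law of cosines; the loss
  2ab(1 - cos t) measures how far two atoms one unit apart are out of phase.\<close>

lemma cmod_add_cis_sq:
  "(cmod (of_real a * cis s + of_real b * cis (s + t)))\<^sup>2 = (a + b)\<^sup>2 - 2 * a * b * (1 - cos t)"
proof -
  have "of_real a * cis s + of_real b * cis (s + t) = cis s * (of_real a + of_real b * cis t)"
    by (simp add: cis_mult[symmetric] algebra_simps)
  then have "(cmod (of_real a * cis s + of_real b * cis (s + t)))\<^sup>2 = (cmod (of_real a + of_real b * cis t))\<^sup>2"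
    by (simp add: norm_mult)
  also have "\<dots> = (a + b * cos t)\<^sup>2 + (b * sin t)\<^sup>2" by (simp add: cmod_power2)
  also have "\<dots> = (a + b)\<^sup>2 - 2 * a * b * (1 - cos t)"
    by (simp add: power_mult_distrib sin_squared_eq) (simp add: power2_eq_square algebra_simps)
  finally show ?thesis .
qed

lemma gaussian_integral:
  fixes c :: real
  assumes "c > 0"
  shows "has_bochner_integral lborel (\<lambda>u. exp (- c * u\<^sup>2)) (sqrt (pi / c))"
proof -
  \<comment> \<open>The standard deviation for which u^2 / (2 s^2) = c u^2.\<close>
  define s where "s = sqrt (1 / (2 * c))"
  have s: "s > 0" "s\<^sup>2 = 1 / (2 * c)" using assms by (auto simp: s_def)
  have "has_bochner_integral lborel (normal_density 0 s) 1"
    using s integrable_normal_moment[of s 0 0] integral_normal_moment_even[of s 0 0]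
    by (simp add: has_bochner_integral_iff)
  then have "has_bochner_integral lborel (\<lambda>u. sqrt (pi / c) * normal_density 0 s u) (sqrt (pi / c) * 1)"
    by (intro has_bochner_integral_mult_right)
  moreover have "sqrt (pi / c) * normal_density 0 s u = exp (- c * u\<^sup>2)" for u
    using assms by (simp add: normal_density_def s real_sqrt_divide field_simps)
  ultimately show ?thesis by simp
qed

section \<open>Rapidly decreasing distributions\<close>

text \<open>No logarithm is taken: z is compared with e = exp(a/N), whose N-th power is exp a. Both
  lie in the unit disc (for e because a <= 0), so |z^N - e^N| <= N |z - e|, and N(z - 1) and N(e -
  1) have the same limit.\<close>

lemma power_tendsto_exp:
  fixes z :: "nat \<Rightarrow> complex" and N :: "nat \<Rightarrow> nat" and a :: real
  assumes N: "filterlim N at_top sequentially"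
    and z: "\<And>j. norm (z j) \<le> 1"
    and lim: "(\<lambda>j. of_nat (N j) * (z j - 1)) \<longlonglongrightarrow> of_real a"
    and a: "a \<le> 0"
  shows "(\<lambda>j. z j ^ N j) \<longlonglongrightarrow> of_real (exp a)"
proof -
  define e where "e = (\<lambda>j. exp (a / real (N j)))"
  have N': "filterlim (\<lambda>j. real (N j)) at_top sequentially"
    by (rule filterlim_compose[OF filterlim_real_sequentially N])
  have ev: "\<forall>\<^sub>F j in sequentially. N j > 0"
    by (rule eventually_compose_filterlim[OF eventually_gt_at_top N])
  have e1: "norm (complex_of_real (e j)) \<le> 1" for j
    using a by (simp add: e_def divide_nonpos_nonneg)
  \<comment> \<open>N(e - 1) is the difference quotient of exp(a h) at 0 with h = 1/N, hence tends
    to a.\<close>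
  have "((\<lambda>x. exp (a * x)) has_real_derivative a) (at 0)"
    by (auto intro!: derivative_eq_intros)
  then have "((\<lambda>h. (exp (a * h) - 1) / h) \<longlongrightarrow> a) (at 0)"
    by (simp add: DERIV_def)
  moreover have "filterlim (\<lambda>j. inverse (real (N j))) (at 0) sequentially"
    using filterlim_at_top_imp_at_infinity[OF N'] by (simp only: filterlim_inverse_at_iff)
  ultimately have "(\<lambda>j. (exp (a * inverse (real (N j))) - 1) / inverse (real (N j))) \<longlonglongrightarrow> a"
    by (rule filterlim_compose)
  then have "(\<lambda>j. real (N j) * (e j - 1)) \<longlonglongrightarrow> a"
    by (simp add: e_def field_simps)
  then have "(\<lambda>j. complex_of_real (real (N j) * (e j - 1))) \<longlonglongrightarrow> of_real a"
    by (rule tendsto_of_real)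
  from tendsto_diff[OF lim this] have "(\<lambda>j. of_nat (N j) * (z j - of_real (e j))) \<longlonglongrightarrow> 0"
    by (simp add: algebra_simps)
  then have "(\<lambda>j. real (N j) * norm (z j - of_real (e j))) \<longlonglongrightarrow> 0"
    by (drule_tac tendsto_norm) (simp add: norm_mult)
  then have "(\<lambda>j. z j ^ N j - of_real (e j) ^ N j) \<longlonglongrightarrow> 0"
    by (rule Lim_null_comparison[rotated])
       (intro always_eventually allI norm_power_diff z e1)
  moreover have "\<forall>\<^sub>F j in sequentially. complex_of_real (e j) ^ N j = of_real (exp a)"
    using ev by eventually_elim (simp add: e_def flip: of_real_power exp_of_nat_mult)
  ultimately have "(\<lambda>j. z j ^ N j - of_real (exp a)) \<longlonglongrightarrow> 0"
    by (rule Lim_transform_eventually[OF _ eventually_mono]) auto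
  then show ?thesis by (simp add: LIM_zero_iff)
qed

lemma suminf_tail_tendsto_zero:
  fixes g :: "nat \<Rightarrow> 'a :: real_normed_vector"
  assumes "summable g"
  shows "(\<lambda>k. \<Sum>j. g (j + Suc k)) \<longlonglongrightarrow> 0"
proof -
  have "(\<lambda>k. \<Sum>i<Suc k. g i) \<longlonglongrightarrow> suminf g"
    using summable_LIMSEQ[OF assms] by (rule LIMSEQ_Suc)
  from tendsto_diff[OF tendsto_const[of "suminf g"] this]
  show ?thesis by (simp add: suminf_minus_initial_segment[OF assms] del: sum.lessThan_Suc add_Suc_right)
qed

definition tail :: "(nat \<Rightarrow> real) \<Rightarrow> nat \<Rightarrow> real" where
  "tail p k = (\<Sum>j. p (j + Suc k))"

text \<open>Abstracts the tilted weights. \<open>p_eventually_pos\<close> makes the quotients in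
  \<open>p_ratio\<close> genuine for large k; finitely many \<open>p k\<close> may vanish, and there
  division by zero yields 0.\<close>

locale rapid_pmf =
  fixes p :: "nat \<Rightarrow> real" and lam :: real
  assumes p_nonneg: "\<And>k. 0 \<le> p k"
    and p_sums: "p sums 1"
    and p_mean: "(\<lambda>k. real k * p k) sums lam"
    and p_eventually_pos: "\<forall>\<^sub>F k in sequentially. 0 < p k"
    and p_ratio: "(\<lambda>k. p (Suc k) / p k) \<longlonglongrightarrow> 0"
begin

lemma eventually_ratio_le:
  assumes "\<epsilon> > 0"
  shows "\<forall>\<^sub>F k in sequentially. 0 < p k \<and> p (Suc k) \<le> \<epsilon> * p k"
  using order_tendstoD(2)[OF p_ratio assms] p_eventually_pos
  by eventually_elim (auto simp: field_simps)

text \<open>Third moments will control the cubic Taylor remainder of the characteristic function.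
  The cube grows by a factor of at most 8 per step, so ratio 1/16 makes the terms at least
  halve.\<close>

lemma summable_cube: "summable (\<lambda>j. (real j + 1) ^ 3 * p j)"
proof -
  obtain K where K: "\<And>k. k \<ge> K \<Longrightarrow> p (Suc k) \<le> (1/16) * p k"
    using eventually_ratio_le[of "1/16"] by (auto simp: eventually_sequentially)
  show ?thesis
  proof (rule summable_ratio_test[of "1/2" K])
    fix n assume n: "n \<ge> K"
    have "(real (Suc n) + 1) ^ 3 \<le> (2 * (real n + 1)) ^ 3"
      by (intro power_mono) auto
    also have "\<dots> = 8 * (real n + 1) ^ 3"
      by (simp only: power_mult_distrib) simp
    finally have "(real (Suc n) + 1) ^ 3 * p (Suc n) \<le> 8 * (real n + 1) ^ 3 * ((1/16) * p n)"
      using K[OF n] p_nonneg by (intro mult_mono) auto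
    then show "norm ((real (Suc n) + 1) ^ 3 * p (Suc n)) \<le> 1/2 * norm ((real n + 1) ^ 3 * p n)"
      using p_nonneg by (simp add: abs_mult mult.commute[of "p n"])
  qed simp
qed

lemma summable_moment:
  assumes "d \<le> 3"
  shows "summable (\<lambda>j. \<bar>real j - lam\<bar> ^ d * p j)"
proof (rule summable_comparison_test'[where N = 0])
  show "summable (\<lambda>j. (1 + \<bar>lam\<bar>) ^ 3 * ((real j + 1) ^ 3 * p j))"
    by (intro summable_mult summable_cube)
  fix j
  have b: "\<bar>real j - lam\<bar> \<le> (1 + \<bar>lam\<bar>) * (real j + 1)"
  proof -
    have "\<bar>real j - lam\<bar> \<le> real j + \<bar>lam\<bar>" by linarith
    also have "\<dots> \<le> (real j + \<bar>lam\<bar>) + (\<bar>lam\<bar> * real j + 1)" by simp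
    also have "\<dots> = (1 + \<bar>lam\<bar>) * (real j + 1)" by (simp add: algebra_simps)
    finally show ?thesis .
  qed
  \<comment> \<open>The majorant is at least 1, so its exponent may be raised from \<open>d\<close>
    to 3.\<close>
  have "(1 + \<bar>lam\<bar>) * (real j + 1) \<ge> 1 * 1" by (intro mult_mono) auto
  then have "\<bar>real j - lam\<bar> ^ d \<le> ((1 + \<bar>lam\<bar>) * (real j + 1)) ^ 3"
    using assms by (intro order_trans[OF power_mono[OF b] power_increasing]) auto
  then show "norm (\<bar>real j - lam\<bar> ^ d * p j) \<le> (1 + \<bar>lam\<bar>) ^ 3 * ((real j + 1) ^ 3 * p j)"
    using p_nonneg[of j] by (simp add: abs_mult power_mult_distrib mult_right_mono flip: mult.assoc)
qed

lemma summable_p: "summable p"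
  using p_sums by (rule sums_summable)

lemma tail_eq: "tail p k = 1 - (\<Sum>j\<le>k. p j)"
  using suminf_minus_initial_segment[OF summable_p, of "Suc k"] sums_unique[OF p_sums]
  by (simp add: tail_def lessThan_Suc_atMost)

lemma tail_nonneg: "0 \<le> tail p k"
  unfolding tail_def using p_nonneg summable_ignore_initial_segment[OF summable_p]
  by (intro suminf_nonneg)

lemma tail_le_1: "tail p k \<le> 1"
  unfolding tail_eq using p_nonneg by (simp add: sum_nonneg)

lemma tail_rec: "tail p k = p (Suc k) + tail p (Suc k)"
  by (simp add: tail_eq)

text \<open>The first step beyond k costs a factor \<epsilon> and every later one at most 1/2, so a
  geometric series bounds the tail by 2 \<epsilon> p_k; \<epsilon> <= r/4 leaves room for the strict
  inequality.\<close>

lemma tail_div_tendsto_zero: "(\<lambda>k. tail p k / p k) \<longlonglongrightarrow> 0"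
proof (rule LIMSEQ_I)
  fix r :: real assume r: "r > 0"
  define \<epsilon> where "\<epsilon> = min (1/2) (r/4)"
  have \<epsilon>: "\<epsilon> > 0" "\<epsilon> \<le> 1/2" "\<epsilon> \<le> r/4" using r by (auto simp: \<epsilon>_def)
  obtain K where K: "\<And>k. k \<ge> K \<Longrightarrow> 0 < p k" "\<And>k. k \<ge> K \<Longrightarrow> p (Suc k) \<le> \<epsilon> * p k"
    using eventually_ratio_le[OF \<epsilon>(1)] by (auto simp: eventually_sequentially)
  have "norm (tail p k / p k - 0) < r" if k: "k \<ge> K" for k
  proof -
    have geo: "p (j + Suc k) \<le> (1/2) ^ j * (\<epsilon> * p k)" for j
    proof (induction j)
      case (Suc j)
      have "p (Suc j + Suc k) \<le> \<epsilon> * p (j + Suc k)" using K(2)[of "j + Suc k"] k by simp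
      also have "\<dots> \<le> (1/2) * p (j + Suc k)" using \<epsilon> p_nonneg by (intro mult_right_mono) auto
      finally show ?case using Suc by simp
    qed (use K(2)[of k] k in simp)
    have "tail p k \<le> (\<Sum>j. (1/2) ^ j * (\<epsilon> * p k))"
      unfolding tail_def using summable_ignore_initial_segment[OF summable_p]
      by (intro suminf_le geo summable_mult2 summable_geometric) (auto simp del: add_Suc_right)
    also have "\<dots> = 2 * (\<epsilon> * p k)"
      by (subst suminf_mult2[symmetric]) (auto simp: suminf_geometric summable_geometric)
    finally have "tail p k / p k \<le> 2 * \<epsilon>" using K(1)[OF k] by (simp add: field_simps)
    moreover have "tail p k / p k \<ge> 0" using tail_nonneg K(1)[OF k] by simp
    ultimately show ?thesis using \<epsilon> r by (simp only: diff_zero real_norm_def)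
  qed
  then show "\<exists>K. \<forall>k\<ge>K. norm (tail p k / p k - 0) < r" by blast
qed

text \<open>Markov's argument: replacing k by the larger index of each term gives the tail of the
  convergent series for the mean. It serves to show n T(m) -> 0.\<close>

lemma mult_tail_tendsto_zero: "(\<lambda>k. real k * tail p k) \<longlonglongrightarrow> 0"
proof (rule tendsto_sandwich[OF _ _ tendsto_const])
  have s: "summable (\<lambda>k. real k * p k)" using p_mean by (rule sums_summable)
  show "(\<lambda>k. \<Sum>j. real (j + Suc k) * p (j + Suc k)) \<longlonglongrightarrow> 0"
    using suminf_tail_tendsto_zero[OF s] .
  show "\<forall>\<^sub>F k in sequentially. 0 \<le> real k * tail p k"
    using tail_nonneg by (intro always_eventually allI) simp
  have "real k * tail p k \<le> (\<Sum>j. real (j + Suc k) * p (j + Suc k))" for k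
  proof -
    have "real k * tail p k = (\<Sum>j. real k * p (j + Suc k))"
      unfolding tail_def using summable_ignore_initial_segment[OF summable_p] by (rule suminf_mult[symmetric])
    also have "\<dots> \<le> (\<Sum>j. real (j + Suc k) * p (j + Suc k))"
      using p_nonneg summable_ignore_initial_segment[OF summable_p] summable_ignore_initial_segment[OF s]
      by (intro suminf_le summable_mult mult_right_mono) (auto simp del: add_Suc_right of_nat_add)
    finally show ?thesis .
  qed
  then show "\<forall>\<^sub>F k in sequentially. real k * tail p k \<le> (\<Sum>j. real (j + Suc k) * p (j + Suc k))"
    by simp
qed

text \<open>Two atoms at distance one make the law aperiodic and non-degenerate; they yield both the
  decay of the characteristic function and the positive variance.\<close>

lemma adjacent_pos:
  obtains a where "p a > 0" "p (Suc a) > 0"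
  using p_eventually_pos by (auto simp: eventually_sequentially) (metis le_refl le_SucI)

text \<open>
  Two adjacent atoms \<open>a\<close> and \<open>a + 1\<close> already force the Gaussian decay; all other terms are bounded trivially.
\<close>
lemma trunc_char_bound:
  obtains c K where "c > 0"
    "\<And>k t. k \<ge> K \<Longrightarrow> \<bar>t\<bar> \<le> pi \<Longrightarrow> cmod (trunc_char p k t) \<le> (1 - tail p k) * exp (- c * t\<^sup>2)"
proof -
  obtain a where a: "p a > 0" "p (Suc a) > 0" by (rule adjacent_pos)
  define c where "c = p a * p (Suc a) / 12"
  have c: "c > 0" using a by (simp add: c_def)
  have "cmod (trunc_char p k t) \<le> (1 - tail p k) * exp (- c * t\<^sup>2)"
    if k: "k \<ge> Suc a" and t: "\<bar>t\<bar> \<le> pi" for k t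
  proof -
    define F where "F = (\<Sum>j\<le>k. p j)"
    define s where "s = p a + p (Suc a)"
    define r where "r = cmod (of_real (p a) * cis (real a * t) + of_real (p (Suc a)) * cis (real a * t + t))"
    define R where "R = {..k} - {a, Suc a}"
    have split: "(\<Sum>j\<le>k. g j) = g a + g (Suc a) + (\<Sum>j\<in>R. g j)" for g :: "nat \<Rightarrow> 'b :: comm_monoid_add"
    proof -
      have "{..k} = insert a (insert (Suc a) R)" using k by (auto simp: R_def)
      then have "(\<Sum>j\<le>k. g j) = (\<Sum>j\<in>insert a (insert (Suc a) R). g j)" by (rule arg_cong)
      then show ?thesis by (simp add: R_def add.assoc)
    qed
    have F: "F = 1 - tail p k" by (simp add: F_def tail_eq)
    have F1: "0 \<le> F" "F \<le> 1" using tail_nonneg tail_le_1 by (auto simp: F)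
    have FR: "F = s + (\<Sum>j\<in>R. p j)" unfolding F_def s_def by (rule split)
    have sF: "s \<le> F" using p_nonneg by (simp add: FR sum_nonneg)
    have r2: "r\<^sup>2 = s\<^sup>2 - 2 * p a * p (Suc a) * (1 - cos t)"
      unfolding r_def s_def by (rule cmod_add_cis_sq)
    have r0: "0 \<le> r" by (simp add: r_def)
    have rs: "r \<le> s"
    proof -
      have "r \<le> cmod (of_real (p a) * cis (real a * t)) + cmod (of_real (p (Suc a)) * cis (real a * t + t))"
        unfolding r_def by (rule norm_triangle_ineq)
      then show ?thesis using a by (simp add: norm_mult s_def)
    qed
    have "cmod (trunc_char p k t) \<le> r + cmod (\<Sum>j\<in>R. of_real (p j) * cis (real j * t))"
      unfolding trunc_char_def split r_def
      by (intro order_trans[OF norm_triangle_ineq]) (simp add: algebra_simps)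
    also have "cmod (\<Sum>j\<in>R. of_real (p j) * cis (real j * t)) \<le> (\<Sum>j\<in>R. p j)"
      using p_nonneg by (intro sum_norm_le) (simp add: norm_mult)
    finally have le: "cmod (trunc_char p k t) \<le> F - s + r" using FR by simp
    have "(cmod (trunc_char p k t))\<^sup>2 \<le> (F - s + r)\<^sup>2" using le by (intro power_mono) auto
    also have "\<dots> = F\<^sup>2 - (s - r) * (2 * F - s + r)" by (simp add: power2_eq_square algebra_simps)
    \<comment> \<open>As s <= F, the factor 2F - s may be lowered to s; then (s - r)(s + r) is
      exactly the loss in the law of cosines.\<close>
    also have "\<dots> \<le> F\<^sup>2 - (s - r) * (s + r)"
      using rs sF by (intro diff_mono mult_left_mono) auto
    also have "\<dots> = F\<^sup>2 - 2 * p a * p (Suc a) * (1 - cos t)"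
      using r2 by (simp add: power2_eq_square algebra_simps)
    also have "\<dots> \<le> F\<^sup>2 - 2 * p a * p (Suc a) * (t\<^sup>2 / 12)"
      using a by (intro diff_mono mult_left_mono one_minus_cos_ge t) auto
    also have "\<dots> = F\<^sup>2 - 1 * (2 * c * t\<^sup>2)" by (simp add: c_def)
    \<comment> \<open>F <= 1 allows F^2 to be factored out, so the mass 1 - T(k) survives in the
      bound; its n-th power later gives exp(-n T(k)).\<close>
    also have "\<dots> \<le> F\<^sup>2 - F\<^sup>2 * (2 * c * t\<^sup>2)"
      using F1 c by (intro diff_mono mult_right_mono) (auto simp: power_le_one)
    also have "\<dots> = F\<^sup>2 * (1 + (- 2 * c * t\<^sup>2))" by (simp add: algebra_simps)
    also have "\<dots> \<le> F\<^sup>2 * exp (- 2 * c * t\<^sup>2)"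
      by (intro mult_left_mono exp_ge_add_one_self) auto
    also have "\<dots> = (F * exp (- c * t\<^sup>2))\<^sup>2"
      by (simp add: power_mult_distrib exp_double[symmetric] mult.assoc)
    finally show ?thesis unfolding F[symmetric]
      by (rule power2_le_imp_le) (use F1 in simp)
  qed
  with c show ?thesis by (rule that)
qed

definition variance :: real where
  "variance = (\<Sum>j. (real j - lam)\<^sup>2 * p j)"

lemma summable_variance: "summable (\<lambda>j. (real j - lam)\<^sup>2 * p j)"
  using summable_moment[of 2] by simp

lemma variance_pos: "variance > 0"
proof -
  obtain a where a: "p a > 0" "p (Suc a) > 0" by (rule adjacent_pos)
  have "real a - lam \<noteq> 0 \<or> real (Suc a) - lam \<noteq> 0" by auto
  then obtain i where "(real i - lam)\<^sup>2 * p i > 0" using a by (metis mult_pos_pos zero_less_power2)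
  then show ?thesis
    unfolding variance_def using p_nonneg by (intro suminf_pos2[OF summable_variance]) auto
qed

section \<open>Local limit theorem for truncated sums\<close>

text \<open>The full centred mean is 0, so the truncated one is minus its tail. Since \<epsilon>^2
  dominates the tail \<open>V\<close> of the second moment, the scaled error is at most \<epsilon>(n
  T + 1), with n T bounded and \<epsilon> -> 0.\<close>

lemma scaled_truncated_mean_tendsto_zero:
  fixes k N :: "nat \<Rightarrow> nat"
  assumes k: "filterlim k at_top sequentially"
    and T: "(\<lambda>j. real (N j) * tail p (k j)) \<longlonglongrightarrow> y"
  shows "(\<lambda>j. sqrt (N j) * (\<Sum>i\<le>k j. (real i - lam) * p i)) \<longlonglongrightarrow> 0"
proof -
  define V where "V = (\<lambda>k. \<Sum>i. (real (i + Suc k) - lam)\<^sup>2 * p (i + Suc k))"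
  \<comment> \<open>The bound comes from \<open>\<surd>n d \<le> \<epsilon> n + d\<^sup>2/\<epsilon>\<close>; the term \<open>1/(k+1)\<close> only keeps \<open>\<epsilon>\<close> positive.\<close>
  define \<epsilon> where "\<epsilon> = (\<lambda>k. sqrt (V k + inverse (real (Suc k))))"
  have shift: "summable (\<lambda>i. g (i + Suc k))" if "summable g" for g :: "nat \<Rightarrow> real" and k
    using that by (rule summable_ignore_initial_segment)
  have V0: "V k \<ge> 0" for k
    unfolding V_def using p_nonneg by (intro suminf_nonneg shift[OF summable_variance]) auto
  have \<epsilon>_pos: "\<epsilon> k > 0" for k
    unfolding \<epsilon>_def using V0[of k] by (simp add: add_nonneg_pos)
  have "V \<longlonglongrightarrow> 0"
    unfolding V_def by (rule suminf_tail_tendsto_zero[OF summable_variance])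
  then have "(\<lambda>k. sqrt (V k + inverse (real (Suc k)))) \<longlonglongrightarrow> sqrt (0 + 0)"
    by (intro tendsto_intros LIMSEQ_inverse_real_of_nat)
  then have \<epsilon>_lim: "\<epsilon> \<longlonglongrightarrow> 0" by (simp add: \<epsilon>_def)
  have mean0: "(\<lambda>i. (real i - lam) * p i) sums 0"
    using sums_diff[OF p_mean sums_mult[OF p_sums, of lam]] by (simp add: algebra_simps)
  have abs_sum: "summable (\<lambda>i. \<bar>real i - lam\<bar> * p i)"
    using summable_moment[of 1] by simp
  have bound: "norm (sqrt n * (\<Sum>i\<le>k. (real i - lam) * p i)) \<le> \<epsilon> k * (real n * tail p k + 1)" for n k :: nat
  proof -
    have "(\<Sum>i\<le>k. (real i - lam) * p i) = - (\<Sum>i. (real (i + Suc k) - lam) * p (i + Suc k))"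
      using suminf_minus_initial_segment[OF sums_summable[OF mean0], of "Suc k"] sums_unique[OF mean0]
      by (simp add: lessThan_Suc_atMost)
    also have "\<bar>\<dots>\<bar> \<le> (\<Sum>i. \<bar>real (i + Suc k) - lam\<bar> * p (i + Suc k))"
      using summable_rabs[of "\<lambda>i. (real (i + Suc k) - lam) * p (i + Suc k)"] shift[OF abs_sum, of k] p_nonneg
      by (simp add: abs_mult del: of_nat_add)
    finally have "norm (sqrt n * (\<Sum>i\<le>k. (real i - lam) * p i)) \<le>
        sqrt n * (\<Sum>i. \<bar>real (i + Suc k) - lam\<bar> * p (i + Suc k))"
      by (simp add: abs_mult mult_left_mono)
    also have "\<dots> = (\<Sum>i. sqrt n * (\<bar>real (i + Suc k) - lam\<bar> * p (i + Suc k)))"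
      by (rule suminf_mult[symmetric, OF shift[OF abs_sum]])
    also have "\<dots> \<le> (\<Sum>i. (\<epsilon> k * real n) * p (i + Suc k) +
        inverse (\<epsilon> k) * ((real (i + Suc k) - lam)\<^sup>2 * p (i + Suc k)))"
    proof (rule suminf_le)
      fix i
      define d where "d = \<bar>real (i + Suc k) - lam\<bar>"
      have "sqrt n * d \<le> \<epsilon> k * real n + inverse (\<epsilon> k) * d\<^sup>2"
      proof -
        have "0 \<le> (\<epsilon> k * sqrt n - d)\<^sup>2" by simp
        also have "\<dots> = (\<epsilon> k)\<^sup>2 * real n - 2 * (\<epsilon> k * (sqrt n * d)) + d\<^sup>2"
          by (simp add: power2_diff power_mult_distrib)
        finally have "2 * (\<epsilon> k * (sqrt n * d)) \<le> (\<epsilon> k)\<^sup>2 * real n + d\<^sup>2" by simp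
        moreover have "0 \<le> \<epsilon> k * (sqrt n * d)" using \<epsilon>_pos[of k] by (simp add: d_def)
        ultimately have "\<epsilon> k * (sqrt n * d) \<le> (\<epsilon> k)\<^sup>2 * real n + d\<^sup>2" by linarith
        also have "\<dots> = \<epsilon> k * (\<epsilon> k * real n + inverse (\<epsilon> k) * d\<^sup>2)"
          using \<epsilon>_pos[of k] by (simp add: field_simps power2_eq_square)
        finally show ?thesis using \<epsilon>_pos[of k] by simp
      qed
      from mult_right_mono[OF this p_nonneg[of "i + Suc k"]]
      show "sqrt n * (\<bar>real (i + Suc k) - lam\<bar> * p (i + Suc k)) \<le> (\<epsilon> k * real n) * p (i + Suc k) +
        inverse (\<epsilon> k) * ((real (i + Suc k) - lam)\<^sup>2 * p (i + Suc k))"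
        unfolding d_def by (simp add: algebra_simps del: of_nat_add of_nat_Suc add_Suc_right)
    qed (intro summable_add summable_mult shift[OF abs_sum] shift[OF summable_p] shift[OF summable_variance])+
    also have "\<dots> = \<epsilon> k * real n * tail p k + inverse (\<epsilon> k) * V k"
      unfolding V_def tail_def
      using shift[OF summable_p, of k] shift[OF summable_variance, of k]
      by (subst suminf_add[symmetric]) (simp_all only: summable_mult suminf_mult)
    also have "inverse (\<epsilon> k) * V k \<le> inverse (\<epsilon> k) * (\<epsilon> k)\<^sup>2"
      using \<epsilon>_pos[of k] V0[of k] by (intro mult_left_mono) (auto simp: \<epsilon>_def)
    also have "\<dots> = \<epsilon> k" using \<epsilon>_pos[of k] by (simp add: field_simps power2_eq_square)
    finally show ?thesis by (simp add: algebra_simps)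
  qed
  have "(\<lambda>j. \<epsilon> (k j) * (real (N j) * tail p (k j) + 1)) \<longlonglongrightarrow> 0 * (y + 1)"
    by (intro tendsto_intros T filterlim_compose[OF \<epsilon>_lim k])
  then show ?thesis
    by (intro Lim_null_comparison[OF always_eventually[OF allI[OF bound]]]) simp
qed

text \<open>Each remainder is at most the cube of its argument, so the sum is at most M |u|^3 /
  N^(3/2), uniformly in the cutoff; the factor N leaves order 1 / sqrt N.\<close>

lemma scaled_cubic_remainder_tendsto_zero:
  fixes k N :: "nat \<Rightarrow> nat"
  assumes N: "filterlim N at_top sequentially"
  shows "(\<lambda>j. of_nat (N j) * (\<Sum>i\<le>k j. of_real (p i) * (cis ((real i - lam) * (u / sqrt (N j))) -
     (1 + \<i> * of_real ((real i - lam) * (u / sqrt (N j))) -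
        of_real (((real i - lam) * (u / sqrt (N j)))\<^sup>2 / 2))))) \<longlonglongrightarrow> 0"
    (is "(\<lambda>j. of_nat (N j) * ?S j) \<longlonglongrightarrow> 0")
proof -
  define M where "M = (\<Sum>i. \<bar>real i - lam\<bar> ^ 3 * p i)"
  have taylor: "cmod (cis x - (1 + \<i> * of_real x - of_real (x\<^sup>2 / 2))) \<le> \<bar>x\<bar> ^ 3" for x
  proof -
    have "(\<Sum>k\<le>2. (\<i> * complex_of_real x) ^ k / fact k) = 1 + \<i> * of_real x - of_real (x\<^sup>2 / 2)"
      by (simp add: numeral_2_eq_2 power2_eq_square algebra_simps)
    with iexp_approx1[of x 2] have "cmod (cis x - (1 + \<i> * of_real x - of_real (x\<^sup>2 / 2))) \<le> \<bar>x\<bar> ^ 3 / fact 3"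
      by (simp add: cis_conv_exp)
    also have "\<dots> \<le> \<bar>x\<bar> ^ 3 / 1" by (intro divide_left_mono) (auto simp: fact_numeral)
    finally show ?thesis by simp
  qed
  have ev: "\<forall>\<^sub>F j in sequentially. N j > 0"
    by (rule eventually_compose_filterlim[OF eventually_gt_at_top N])
  have N': "filterlim (\<lambda>j. sqrt (real (N j))) at_top sequentially"
    by (rule filterlim_compose[OF sqrt_at_top filterlim_compose[OF filterlim_real_sequentially N]])
  have bound: "\<forall>\<^sub>F j in sequentially. norm (of_nat (N j) * ?S j) \<le> M * \<bar>u\<bar> ^ 3 / sqrt (N j)"
    using ev
  proof eventually_elim
    case (elim j)
    define v where "v = u / sqrt (N j)"
    have "norm (?S j) \<le> (\<Sum>i\<le>k j. (\<bar>real i - lam\<bar> ^ 3 * p i) * \<bar>v\<bar> ^ 3)"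
    proof (rule sum_norm_le)
      fix i
      show "norm (complex_of_real (p i) * (cis ((real i - lam) * (u / sqrt (N j))) -
     (1 + \<i> * of_real ((real i - lam) * (u / sqrt (N j))) -
        of_real (((real i - lam) * (u / sqrt (N j)))\<^sup>2 / 2)))) \<le> (\<bar>real i - lam\<bar> ^ 3 * p i) * \<bar>v\<bar> ^ 3"
        unfolding v_def[symmetric] norm_mult norm_of_real
        using mult_left_mono[OF taylor[of "(real i - lam) * v"] p_nonneg[of i]] p_nonneg[of i]
        by (simp only: abs_mult power_mult_distrib abs_of_nonneg mult_ac)
    qed
    also have "\<dots> = (\<Sum>i\<le>k j. \<bar>real i - lam\<bar> ^ 3 * p i) * \<bar>v\<bar> ^ 3" by (simp add: sum_distrib_right)
    also have "\<dots> \<le> M * \<bar>v\<bar> ^ 3"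
      unfolding M_def using p_nonneg by (intro mult_right_mono sum_le_suminf summable_moment) auto
    finally have "norm (of_nat (N j) * ?S j) \<le> real (N j) * (M * \<bar>v\<bar> ^ 3)"
      by (simp add: norm_mult mult_left_mono)
    also have "real (N j) * (M * \<bar>v\<bar> ^ 3) = M * \<bar>u\<bar> ^ 3 / sqrt (N j)"
    proof -
      have "real (N j) = sqrt (N j) * sqrt (N j)" by simp
      then show ?thesis using elim
        by (simp add: v_def power_divide power3_eq_cube field_simps del: real_sqrt_mult_self)
    qed
    finally show ?case .
  qed
  have "(\<lambda>j. M * \<bar>u\<bar> ^ 3 / sqrt (N j)) \<longlonglongrightarrow> 0"
    by (intro tendsto_divide_0[OF tendsto_const] filterlim_at_top_imp_at_infinity N')
  with bound show ?thesis by (rule Lim_null_comparison)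
qed

text \<open>Centring each variable at \<open>lam\<close> turns the product into z^N times a
  vanishing phase. Then N(z - 1) splits into the cubic remainder (limit 0), the truncated mean
  (limit 0), the second moment (limit - variance u^2 / 2) and the lost mass - N T (limit
  -y).\<close>

lemma scaled_char_tendsto:
  fixes k N :: "nat \<Rightarrow> nat"
  assumes k: "filterlim k at_top sequentially"
    and N: "filterlim N at_top sequentially"
    and T: "(\<lambda>j. real (N j) * tail p (k j)) \<longlonglongrightarrow> y"
    and M: "(\<lambda>j. (real (M j) - lam * real (N j)) / sqrt (real (N j))) \<longlonglongrightarrow> 0"
  shows "(\<lambda>j. trunc_char p (k j) (u / sqrt (N j)) ^ N j * cis (- real (M j) * (u / sqrt (N j))))
     \<longlonglongrightarrow> of_real (exp (- y - variance * u\<^sup>2 / 2))"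
proof -
  define z where "z = (\<lambda>j. \<Sum>i\<le>k j. of_real (p i) * cis ((real i - lam) * (u / sqrt (N j))))"
  define S where "S = (\<lambda>j. \<Sum>i\<le>k j. of_real (p i) * (cis ((real i - lam) * (u / sqrt (N j))) -
     (1 + \<i> * of_real ((real i - lam) * (u / sqrt (N j))) -
        of_real (((real i - lam) * (u / sqrt (N j)))\<^sup>2 / 2))))"
  define A where "A = (\<lambda>j. \<Sum>i\<le>k j. (real i - lam) * p i)"
  define B where "B = (\<lambda>j. \<Sum>i\<le>k j. (real i - lam)\<^sup>2 * p i)"
  have ev: "\<forall>\<^sub>F j in sequentially. N j > 0"
    by (rule eventually_compose_filterlim[OF eventually_gt_at_top N])
  have z1: "norm (z j) \<le> 1" for j
  proof -
    have "norm (z j) \<le> (\<Sum>i\<le>k j. p i)"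
      unfolding z_def using p_nonneg by (intro sum_norm_le) (simp add: norm_mult)
    also have "\<dots> \<le> 1" using tail_nonneg[of "k j"] by (simp add: tail_eq)
    finally show ?thesis .
  qed
  have "(\<lambda>j. of_nat (N j) * S j + \<i> * of_real (u * (sqrt (N j) * A j))
      - of_real (u\<^sup>2 / 2 * B j) - of_real (real (N j) * tail p (k j)))
     \<longlonglongrightarrow> 0 + \<i> * of_real (u * 0) - of_real (u\<^sup>2 / 2 * variance) - of_real y"
  proof (intro tendsto_intros T)
    show "(\<lambda>j. of_nat (N j) * S j) \<longlonglongrightarrow> 0"
      unfolding S_def by (rule scaled_cubic_remainder_tendsto_zero[OF N])
    show "(\<lambda>j. sqrt (N j) * A j) \<longlonglongrightarrow> 0"
      unfolding A_def by (rule scaled_truncated_mean_tendsto_zero[OF k T])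
    have "(\<lambda>n. \<Sum>i\<le>n. (real i - lam)\<^sup>2 * p i) \<longlonglongrightarrow> variance"
      unfolding variance_def by (rule summable_LIMSEQ'[OF summable_variance])
    then show "B \<longlonglongrightarrow> variance"
      unfolding B_def by (rule filterlim_compose[OF _ k])
  qed
  moreover have "\<forall>\<^sub>F j in sequentially. of_nat (N j) * S j + \<i> * of_real (u * (sqrt (N j) * A j))
      - of_real (u\<^sup>2 / 2 * B j) - of_real (real (N j) * tail p (k j)) = of_nat (N j) * (z j - 1)"
    using ev
  proof eventually_elim
    case (elim j)
    define v where "v = u / sqrt (N j)"
    have "S j = z j - (of_real (\<Sum>i\<le>k j. p i) + \<i> * of_real (v * A j) - of_real (v\<^sup>2 / 2 * B j))"
    proof -
      have expand: "of_real P * (X - (1 + \<i> * of_real (d * v) - of_real ((d * v)\<^sup>2 / 2))) =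
          of_real P * X - (of_real P + \<i> * of_real (v * (d * P)) - of_real (v\<^sup>2 / 2 * (d\<^sup>2 * P)))"
        for P d :: real and X :: complex
        by (simp add: power_mult_distrib algebra_simps)
      have "S j = (\<Sum>i\<le>k j. of_real (p i) * cis ((real i - lam) * v) - (of_real (p i)
          + \<i> * of_real (v * ((real i - lam) * p i)) - of_real (v\<^sup>2 / 2 * ((real i - lam)\<^sup>2 * p i))))"
        unfolding S_def v_def[symmetric]
        by (intro sum.cong refl expand)
      then show ?thesis
        unfolding z_def A_def B_def v_def[symmetric]
        by (simp add: sum_subtractf sum.distrib sum_distrib_left)
    qed
    \<comment> \<open>The order-zero coefficient is the retained mass 1 - T(k), which is how the
      tail enters the exponent.\<close>
    then have S: "S j = z j - (1 - of_real (tail p (k j)) + \<i> * of_real (v * A j) - of_real (v\<^sup>2 / 2 * B j))"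
      by (simp add: tail_eq)
    have Nv: "real (N j) * (v * A j) = u * (sqrt (N j) * A j)"
    proof -
      have "real (N j) = sqrt (N j) * sqrt (N j)" by simp
      then show ?thesis using elim by (simp add: v_def field_simps del: real_sqrt_mult_self)
    qed
    have Nv2: "real (N j) * (v\<^sup>2 / 2 * B j) = u\<^sup>2 / 2 * B j"
      using elim by (simp add: v_def power_divide)
    have "of_nat (N j) * S j = of_nat (N j) * (z j - 1) + of_real (real (N j) * tail p (k j))
        - \<i> * of_real (real (N j) * (v * A j)) + of_real (real (N j) * (v\<^sup>2 / 2 * B j))"
      unfolding S by (simp add: algebra_simps)
    then show ?case unfolding Nv Nv2 by simp
  qed
  ultimately have "(\<lambda>j. of_nat (N j) * (z j - 1))
     \<longlonglongrightarrow> 0 + \<i> * of_real (u * 0) - of_real (u\<^sup>2 / 2 * variance) - of_real y"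
    by (rule Lim_transform_eventually)
  then have lim: "(\<lambda>j. of_nat (N j) * (z j - 1)) \<longlonglongrightarrow> of_real (- (u\<^sup>2 / 2 * variance) - y)"
    by simp
  have "y \<ge> 0"
    using tail_nonneg by (intro LIMSEQ_le_const[OF T]) auto
  moreover have "u\<^sup>2 / 2 * variance \<ge> 0" using variance_pos by simp
  ultimately have "- (u\<^sup>2 / 2 * variance) - y \<le> 0" by linarith
  from power_tendsto_exp[OF N z1 lim this]
  have "(\<lambda>j. z j ^ N j) \<longlonglongrightarrow> of_real (exp (- y - variance * u\<^sup>2 / 2))"
    by (rule tendsto_eq_rhs) (simp add: algebra_simps)
  \<comment> \<open>N centring factors use up the phase of lam N; only that of M - lam N = o(sqrt N)
    is left.\<close>
  moreover have "(\<lambda>j. cis (- u * ((real (M j) - lam * real (N j)) / sqrt (real (N j))))) \<longlonglongrightarrow> cis (- u * 0)"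
    by (intro tendsto_intros M)
  ultimately have "(\<lambda>j. z j ^ N j * cis (- u * ((real (M j) - lam * real (N j)) / sqrt (real (N j)))))
     \<longlonglongrightarrow> of_real (exp (- y - variance * u\<^sup>2 / 2)) * cis (- u * 0)"
    by (rule tendsto_mult)
  moreover have "z j ^ N j * cis (- u * ((real (M j) - lam * real (N j)) / sqrt (real (N j)))) =
      trunc_char p (k j) (u / sqrt (N j)) ^ N j * cis (- real (M j) * (u / sqrt (N j)))" for j
  proof -
    define v where "v = u / sqrt (N j)"
    have z: "z j = trunc_char p (k j) v * cis (- lam * v)"
      unfolding z_def trunc_char_def v_def[symmetric] sum_distrib_right
      by (intro sum.cong) (auto simp: mult.assoc cis_mult algebra_simps)
    have arg: "- u * ((real (M j) - lam * real (N j)) / sqrt (real (N j))) = - (real (M j) - lam * real (N j)) * v"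
      by (simp only: v_def divide_inverse mult_ac mult_minus_left mult_minus_right)
    have "cis (- lam * v) ^ N j * cis (- (real (M j) - lam * real (N j)) * v) = cis (- real (M j) * v)"
      by (simp only: Complex.DeMoivre cis_mult) (simp add: algebra_simps)
    then show ?thesis
      unfolding z arg v_def[symmetric] by (simp only: power_mult_distrib mult.assoc)
  qed
  ultimately show ?thesis by simp
qed

end

lemma trunc_char_measurable [measurable]: "trunc_char p k \<in> borel_measurable borel"
  unfolding trunc_char_def by (intro borel_measurable_continuous_onI continuous_intros)

lemma cis_measurable [measurable]: "cis \<in> borel_measurable borel"
  by (intro borel_measurable_continuous_onI continuous_intros)

context rapid_pmf
begin

text \<open>The n-th power of the two-atom bound, with 1 - T <= exp(-T). The Gaussian factor
  dominates the integrand uniformly in n and m, and the factor exp(-n T) forces vanishing when n T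
  is unbounded.\<close>

lemma scaled_char_bound:
  obtains c K where "c > 0"
    "\<And>k n m u. k \<ge> K \<Longrightarrow> n > 0 \<Longrightarrow>
      norm (indicator {- pi * sqrt (real n)..pi * sqrt (real n)} u *\<^sub>R
       (trunc_char p k (u / sqrt (real n)) ^ n * cis (- real m * (u / sqrt (real n)))))
      \<le> exp (- (real n * tail p k)) * exp (- c * u\<^sup>2)"
proof -
  obtain c K where c: "c > 0" and K: "\<And>k t. k \<ge> K \<Longrightarrow> \<bar>t\<bar> \<le> pi \<Longrightarrow>
     cmod (trunc_char p k t) \<le> (1 - tail p k) * exp (- c * t\<^sup>2)"
    by (rule trunc_char_bound) blast
  have "norm (indicator {- pi * sqrt (real n)..pi * sqrt (real n)} u *\<^sub>R
       (trunc_char p k (u / sqrt (real n)) ^ n * cis (- real m * (u / sqrt (real n)))))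
      \<le> exp (- (real n * tail p k)) * exp (- c * u\<^sup>2)" if k: "k \<ge> K" and n: "n > 0" for k n m u
  proof (cases "u \<in> {- pi * sqrt (real n)..pi * sqrt (real n)}")
    case True
    have s: "sqrt (real n) > 0" using n by simp
    have "\<bar>u / sqrt (real n)\<bar> \<le> pi" using True s by (auto simp: abs_le_iff field_simps)
    from K[OF k this] have "cmod (trunc_char p k (u / sqrt n)) \<le> (1 - tail p k) * exp (- c * (u / sqrt n)\<^sup>2)" .
    also have "\<dots> \<le> exp (- tail p k) * exp (- c * (u / sqrt n)\<^sup>2)"
      using exp_ge_add_one_self[of "- tail p k"] by (intro mult_right_mono) auto
    finally have "cmod (trunc_char p k (u / sqrt n)) ^ n \<le> (exp (- tail p k) * exp (- c * (u / sqrt n)\<^sup>2)) ^ n"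
      by (intro power_mono) auto
    also have "\<dots> = exp (- (real n * tail p k)) * exp (- c * u\<^sup>2)"
      using n by (simp add: power_mult_distrib power_divide flip: exp_of_nat_mult)
    finally show ?thesis using True by (simp add: norm_mult norm_power)
  qed auto
  with c show ?thesis by (rule that)
qed

text \<open>Dominated convergence in the rescaled inversion formula: the limit integrand is a
  Gaussian times exp(-y).\<close>

lemma local_limit:
  fixes k N M :: "nat \<Rightarrow> nat"
  assumes k: "filterlim k at_top sequentially"
    and N: "filterlim N at_top sequentially"
    and T: "(\<lambda>j. real (N j) * tail p (k j)) \<longlonglongrightarrow> y"
    and M: "(\<lambda>j. (real (M j) - lam * real (N j)) / sqrt (real (N j))) \<longlonglongrightarrow> 0"
  shows "(\<lambda>j. sqrt (N j) * box_sum p (k j) (N j) (M j)) \<longlonglongrightarrow> exp (- y) / sqrt (2 * pi * variance)"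
proof -
  define f where "f = (\<lambda>j u. indicator {- pi * sqrt (N j)..pi * sqrt (N j)} u *\<^sub>R
       (trunc_char p (k j) (u / sqrt (N j)) ^ N j * cis (- real (M j) * (u / sqrt (N j)))))"
  define g where "g = (\<lambda>u. complex_of_real (exp (- y) * exp (- (variance / 2) * u\<^sup>2)))"
  obtain c K where c: "c > 0" and bound: "\<And>k n m u. k \<ge> K \<Longrightarrow> n > 0 \<Longrightarrow>
      norm (indicator {- pi * sqrt (real n)..pi * sqrt (real n)} u *\<^sub>R
       (trunc_char p k (u / sqrt (real n)) ^ n * cis (- real m * (u / sqrt (real n)))))
      \<le> exp (- (real n * tail p k)) * exp (- c * u\<^sup>2)"
    by (rule scaled_char_bound) blast
  have "\<forall>\<^sub>F j in sequentially. N j > 0 \<and> k j \<ge> K"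
    using eventually_compose_filterlim[OF eventually_gt_at_top[of 0] N]
      eventually_compose_filterlim[OF eventually_ge_at_top[of K] k] by eventually_elim simp
  \<comment> \<open>The domination holds only for large j, so the sequence is shifted by
    \<open>J\<close>; \<open>LIMSEQ_offset\<close> undoes the shift.\<close>
  then obtain J where J: "\<And>j. j \<ge> J \<Longrightarrow> N j > 0" "\<And>j. j \<ge> J \<Longrightarrow> k j \<ge> K"
    by (auto simp: eventually_sequentially)
  have g_int: "has_bochner_integral lborel g (of_real (exp (- y) * sqrt (pi / (variance / 2))))"
    unfolding g_def using variance_pos
    by (intro has_bochner_integral_of_real has_bochner_integral_mult_right gaussian_integral) auto
  have "(\<lambda>j. integral\<^sup>L lborel (f (j + J))) \<longlonglongrightarrow> integral\<^sup>L lborel g"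
  proof (rule integral_dominated_convergence[where w = "\<lambda>u. exp (- c * u\<^sup>2)"])
    show "g \<in> borel_measurable lborel" "\<And>j. f (j + J) \<in> borel_measurable lborel"
      unfolding g_def f_def by measurable
    show "integrable lborel (\<lambda>u. exp (- c * u\<^sup>2))"
      using gaussian_integral[OF c] by (simp add: has_bochner_integral_iff)
    show "AE u in lborel. norm (f (j + J) u) \<le> exp (- c * u\<^sup>2)" for j
    proof (intro AE_I2)
      fix u
      have "norm (f (j + J) u) \<le> exp (- (real (N (j + J)) * tail p (k (j + J)))) * exp (- c * u\<^sup>2)"
        unfolding f_def using J by (intro bound) auto
      also have "\<dots> \<le> 1 * exp (- c * u\<^sup>2)" using tail_nonneg by (intro mult_right_mono) auto
      finally show "norm (f (j + J) u) \<le> exp (- c * u\<^sup>2)" by simp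
    qed
    show "AE u in lborel. (\<lambda>j. f (j + J) u) \<longlonglongrightarrow> g u"
    proof (intro AE_I2 LIMSEQ_ignore_initial_segment)
      fix u
      have "filterlim (\<lambda>j. pi * sqrt (N j)) at_top sequentially"
        by (intro filterlim_tendsto_pos_mult_at_top[OF tendsto_const] filterlim_compose[OF sqrt_at_top]
              filterlim_compose[OF filterlim_real_sequentially N]) auto
      \<comment> \<open>For fixed u the growing window eventually contains u, so the indicator
        disappears.\<close>
      from eventually_compose_filterlim[OF eventually_ge_at_top[of "\<bar>u\<bar>"] this]
      have "\<forall>\<^sub>F j in sequentially. trunc_char p (k j) (u / sqrt (N j)) ^ N j * cis (- real (M j) * (u / sqrt (N j))) = f j u"
        by eventually_elim (auto simp: f_def indicator_def)
      with scaled_char_tendsto[OF k N T M, of u]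
      have "(\<lambda>j. f j u) \<longlonglongrightarrow> of_real (exp (- y - variance * u\<^sup>2 / 2))"
        by (rule Lim_transform_eventually)
      also have "exp (- y - variance * u\<^sup>2 / 2) = exp (- y) * exp (- (variance / 2) * u\<^sup>2)"
        by (simp flip: exp_add)
      finally show "(\<lambda>j. f j u) \<longlonglongrightarrow> g u" by (simp add: g_def)
    qed
  qed
  also have "(\<lambda>j. integral\<^sup>L lborel (f (j + J))) = (\<lambda>j. of_real (2 * pi *
      (sqrt (N (j + J)) * box_sum p (k (j + J)) (N (j + J)) (M (j + J)))))"
    unfolding f_def by (intro ext box_sum_fourier_scaled[symmetric] J) auto
  also have "integral\<^sup>L lborel g = of_real (exp (- y) * sqrt (pi / (variance / 2)))"
    using g_int by (simp add: has_bochner_integral_iff)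
  finally have "(\<lambda>j. 2 * pi * (sqrt (N (j + J)) * box_sum p (k (j + J)) (N (j + J)) (M (j + J))))
      \<longlonglongrightarrow> exp (- y) * sqrt (pi / (variance / 2))"
    by (simp only: tendsto_of_real_iff)
  then have "(\<lambda>j. 2 * pi * (sqrt (N j) * box_sum p (k j) (N j) (M j))) \<longlonglongrightarrow> exp (- y) * sqrt (pi / (variance / 2))"
    by (rule LIMSEQ_offset)
  then have lim: "(\<lambda>j. 2 * pi * (sqrt (N j) * box_sum p (k j) (N j) (M j)) / (2 * pi))
      \<longlonglongrightarrow> exp (- y) * sqrt (pi / (variance / 2)) / (2 * pi)"
    by (intro tendsto_divide tendsto_const) auto
  have const: "sqrt (pi / (variance / 2)) / (2 * pi) = 1 / sqrt (2 * pi * variance)"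
  proof -
    have "sqrt (pi / (variance / 2)) / (2 * pi) = sqrt (pi / (variance / 2) / (2 * pi)\<^sup>2)"
      by (simp only: real_sqrt_divide[of _ "(2 * pi)\<^sup>2"] real_sqrt_abs) simp
    also have "pi / (variance / 2) / (2 * pi)\<^sup>2 = 1 / (2 * pi * variance)"
      using variance_pos by (simp add: power2_eq_square field_simps)
    finally show ?thesis by (simp add: real_sqrt_divide)
  qed
  show ?thesis
    using lim unfolding times_divide_eq_right[symmetric] const by simp
qed

text \<open>The integral of the dominating function, exp(-n T) sqrt(pi / c), already tends to 0, so
  no pointwise limit of the integrand enters.\<close>

lemma local_vanishing:
  fixes k N M :: "nat \<Rightarrow> nat"
  assumes k: "filterlim k at_top sequentially"
    and N: "filterlim N at_top sequentially"
    and T: "filterlim (\<lambda>j. real (N j) * tail p (k j)) at_top sequentially"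
  shows "(\<lambda>j. sqrt (N j) * box_sum p (k j) (N j) (M j)) \<longlonglongrightarrow> 0"
proof -
  obtain c K where c: "c > 0" and bound: "\<And>k n m u. k \<ge> K \<Longrightarrow> n > 0 \<Longrightarrow>
      norm (indicator {- pi * sqrt (real n)..pi * sqrt (real n)} u *\<^sub>R
       (trunc_char p k (u / sqrt (real n)) ^ n * cis (- real m * (u / sqrt (real n)))))
      \<le> exp (- (real n * tail p k)) * exp (- c * u\<^sup>2)"
    by (rule scaled_char_bound) blast
  have "\<forall>\<^sub>F j in sequentially. norm (2 * pi * (sqrt (N j) * box_sum p (k j) (N j) (M j))) \<le>
      exp (- (real (N j) * tail p (k j))) * sqrt (pi / c)"
    using eventually_compose_filterlim[OF eventually_gt_at_top[of 0] N]
      eventually_compose_filterlim[OF eventually_ge_at_top[of K] k]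
  proof eventually_elim
    case (elim j)
    have G: "has_bochner_integral lborel (\<lambda>u. exp (- (real (N j) * tail p (k j))) * exp (- c * u\<^sup>2))
        (exp (- (real (N j) * tail p (k j))) * sqrt (pi / c))"
      by (intro has_bochner_integral_mult_right gaussian_integral c)
    have "norm (complex_of_real (2 * pi * (sqrt (N j) * box_sum p (k j) (N j) (M j)))) \<le>
       (LINT u|lborel. exp (- (real (N j) * tail p (k j))) * exp (- c * u\<^sup>2))"
      unfolding box_sum_fourier_scaled[OF elim(1)]
    proof (rule Bochner_Integration.integral_norm_bound_integral)
      show int: "integrable lborel (\<lambda>u. exp (- (real (N j) * tail p (k j))) * exp (- c * u\<^sup>2))"
        using G by (simp only: has_bochner_integral_iff)
      show "integrable lborel (\<lambda>u. indicator {- pi * sqrt (N j)..pi * sqrt (N j)} u *\<^sub>R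
         (trunc_char p (k j) (u / sqrt (N j)) ^ N j * cis (- real (M j) * (u / sqrt (N j)))))"
      proof (rule Bochner_Integration.integrable_bound[OF int])
        show "(\<lambda>u. indicator {- pi * sqrt (N j)..pi * sqrt (N j)} u *\<^sub>R
         (trunc_char p (k j) (u / sqrt (N j)) ^ N j * cis (- real (M j) * (u / sqrt (N j)))))
           \<in> borel_measurable lborel" by measurable
      qed (intro AE_I2 order_trans[OF bound[OF elim(2,1)]], simp)
    qed (rule bound[OF elim(2,1)])
    then show ?case using G by (simp only: has_bochner_integral_iff norm_of_real real_norm_def)
  qed
  moreover have "(\<lambda>j. exp (- (real (N j) * tail p (k j))) * sqrt (pi / c)) \<longlonglongrightarrow> 0 * sqrt (pi / c)"
    by (intro tendsto_mult tendsto_const filterlim_compose[OF exp_at_bot]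
       filterlim_compose[OF filterlim_uminus_at_bot_at_top] T)
  ultimately have "(\<lambda>j. 2 * pi * (sqrt (N j) * box_sum p (k j) (N j) (M j))) \<longlonglongrightarrow> 0"
    by (rule Lim_null_comparison[OF _ tendsto_eq_rhs]) simp
  from tendsto_mult_left[OF this, of "1 / (2 * pi)"] show ?thesis by simp
qed

end

section \<open>The largest box\<close>

lemma Zbb_eq_box_sum: "Zbb w m n = box_sum w m n m"
  by (simp add: Zbb_def Bset_def wt_def box_sum_def)

text \<open>The maximum is k exactly when all boxes are at most k but not all are at most k - 1; k >
  0 keeps the natural subtraction honest.\<close>

lemma Pmax_eq_box_sum:
  assumes "n > 0" "k > 0"
  shows "Pmax w m n k = (box_sum w k n m - box_sum w (k - 1) n m) / box_sum w m n m"
proof -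
  define A where "A = (\<lambda>k. {y \<in> PiE {..<n} (\<lambda>_. {..k}). (\<Sum>i<n. y i) = m})"
  \<comment> \<open>The cap \<open>m\<close> built into \<open>Bset\<close> is implied by the total,
    so \<open>Bset\<close> can be compared with the sets of any cap.\<close>
  have le_m: "y i \<le> m" if "(\<Sum>i<n. y i) = m" "i < n" for y :: "nat \<Rightarrow> nat" and i
    using member_le_sum[of i "{..<n}" y] that by auto
  have fin: "finite (A k)" for k
    unfolding A_def by (intro finite_subset[OF _ finite_PiE[of "{..<n}" "\<lambda>_. {..k}"]]) auto
  have sub: "A (k - 1) \<subseteq> A k"
    by (auto simp: A_def PiE_iff intro: le_trans[OF _ diff_le_self])
  have Max_eq: "Max (y ` {..<n}) = k \<longleftrightarrow> (\<exists>i<n. y i = k) \<and> (\<forall>i<n. y i \<le> k)" for y :: "nat \<Rightarrow> nat"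
    using assms(1) by (subst Max_eq_iff) auto
  have "{y \<in> Bset m n. Max (y ` {..<n}) = k} = A k - A (k - 1)"
  proof (intro set_eqI iffI)
    fix y assume y: "y \<in> {y \<in> Bset m n. Max (y ` {..<n}) = k}"
    then obtain i where "i < n" "y i = k" unfolding Max_eq mem_Collect_eq by blast
    then have "i \<in> {..<n}" "\<not> y i \<le> k - 1" using assms(2) by auto
    then have "y \<notin> A (k - 1)" unfolding A_def PiE_iff by blast
    then show "y \<in> A k - A (k - 1)"
      using y unfolding Max_eq mem_Collect_eq by (auto simp: A_def Bset_def PiE_iff)
  next
    fix y assume y: "y \<in> A k - A (k - 1)"
    then obtain i where "i < n" "\<not> y i \<le> k - 1" "y i \<le> k"
      by (auto simp: A_def PiE_iff)
    then have "\<exists>i<n. y i = k" by (intro exI[of _ i]) auto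
    then show "y \<in> {y \<in> Bset m n. Max (y ` {..<n}) = k}"
      using y le_m[of y] unfolding Max_eq mem_Collect_eq by (auto simp: A_def Bset_def PiE_iff)
  qed
  then have "(\<Sum>y\<in>{y \<in> Bset m n. Max (y ` {..<n}) = k}. wt w n y) = sum (wt w n) (A k) - sum (wt w n) (A (k - 1))"
    using sum_diff[OF fin sub] by simp
  then show ?thesis
    by (simp add: Pmax_def Zbb_eq_box_sum) (simp add: box_sum_def A_def wt_def)
qed

text \<open>Every configuration of total m in n boxes acquires the same factor t^m / C^n, which
  cancels in probabilities.\<close>

lemma box_sum_tilt:
  "box_sum (\<lambda>k. t ^ k * w k / C) k n m = t ^ m / C ^ n * box_sum w k n m"
  unfolding box_sum_def sum_distrib_left
  by (intro sum.cong) (auto simp: prod.distrib prod_dividef power_sum)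

lemma Pmax_tilt:
  assumes "n > 0" "k > 0" "t \<noteq> 0" "C \<noteq> 0"
  shows "Pmax (\<lambda>k. t ^ k * w k / C) m n k = Pmax w m n k"
  unfolding Pmax_eq_box_sum[OF assms(1,2)] box_sum_tilt
  using assms(3,4)
  by (simp only: right_diff_distrib[symmetric]) (rule mult_divide_mult_cancel_left, simp)

text \<open>A function on the naturals, monotone or not, is bounded on each initial segment. Thus
  n_k -> infinity along the sequence forces k -> infinity.\<close>

lemma filterlim_at_top_of_comp:
  fixes f k :: "nat \<Rightarrow> nat"
  assumes "filterlim (\<lambda>j. f (k j)) at_top F"
  shows "filterlim k at_top F"
  unfolding filterlim_at_top
proof
  fix Z
  have "\<forall>\<^sub>F j in F. Max (f ` {..Z}) < f (k j)"
    by (rule eventually_compose_filterlim[OF eventually_gt_at_top assms])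
  then show "\<forall>\<^sub>F j in F. Z \<le> k j"
  proof eventually_elim
    case (elim j)
    show ?case
    proof (rule ccontr)
      assume "\<not> Z \<le> k j"
      then have "f (k j) \<le> Max (f ` {..Z})" by (intro Max_ge) auto
      with elim show False by (meson leD)
    qed
  qed
qed

lemma filterlim_diff_const_nat:
  fixes k :: "nat \<Rightarrow> nat"
  assumes "filterlim k at_top F"
  shows "filterlim (\<lambda>j. k j - c) at_top F"
  unfolding filterlim_at_top
proof
  fix Z
  show "\<forall>\<^sub>F j in F. Z \<le> k j - c"
    using eventually_compose_filterlim[OF eventually_ge_at_top[of "Z + c"] assms] by eventually_elim simp
qed

context rapid_pmf
begin

lemma tail_pred: "k > 0 \<Longrightarrow> tail p (k - 1) = p k + tail p k"
  using tail_rec[of "k - 1"] by simp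

lemma p_tendsto_zero: "p \<longlonglongrightarrow> 0"
  using summable_p by (rule summable_LIMSEQ_zero)

text \<open>The floor loses at most 1, a relative error of p_k -> 0; conditions on n / n_k thereby
  become conditions on n p_k.\<close>

lemma floor_inverse_mult_tendsto: "(\<lambda>k. real (nat \<lfloor>1 / p k\<rfloor>) * p k) \<longlonglongrightarrow> 1"
proof (rule tendsto_sandwich)
  show "(\<lambda>k. 1 - p k) \<longlonglongrightarrow> 1" using tendsto_diff[OF tendsto_const[of 1] p_tendsto_zero] by simp
  show "\<forall>\<^sub>F k in sequentially. 1 - p k \<le> real (nat \<lfloor>1 / p k\<rfloor>) * p k"
    using p_eventually_pos
  proof eventually_elim
    case (elim k)
    have "1 / p k - 1 \<le> real (nat \<lfloor>1 / p k\<rfloor>)" using elim by linarith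
    from mult_right_mono[OF this, of "p k"] show ?case using elim by (simp add: algebra_simps)
  qed
  show "\<forall>\<^sub>F k in sequentially. real (nat \<lfloor>1 / p k\<rfloor>) * p k \<le> 1"
    using p_eventually_pos
  proof eventually_elim
    case (elim k)
    have "real (nat \<lfloor>1 / p k\<rfloor>) \<le> 1 / p k" using elim by (simp add: of_nat_nat)
    from mult_right_mono[OF this, of "p k"] show ?case using elim by simp
  qed
qed simp

section \<open>Limit laws along sequences of box numbers \<open>N\<close> and ball numbers
  \<open>M\<close>\<close>

context
  fixes N M :: "nat \<Rightarrow> nat"
  assumes lam_pos: "0 < lam"
    and N: "filterlim N at_top sequentially"
    and M: "(\<lambda>j. (real (M j) - lam * real (N j)) / sqrt (real (N j))) \<longlonglongrightarrow> 0"
begin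

lemma N_real: "filterlim (\<lambda>j. real (N j)) at_top sequentially"
  by (rule filterlim_compose[OF filterlim_real_sequentially N])

lemma N_pos: "\<forall>\<^sub>F j in sequentially. N j > 0"
  by (rule eventually_compose_filterlim[OF eventually_gt_at_top N])

lemma M_div_N: "(\<lambda>j. real (M j) / real (N j)) \<longlonglongrightarrow> lam"
proof -
  have "(\<lambda>j. (real (M j) - lam * real (N j)) / sqrt (real (N j)) * inverse (sqrt (real (N j))) + lam) \<longlonglongrightarrow> 0 * 0 + lam"
    by (intro tendsto_intros M tendsto_inverse_0_at_top filterlim_compose[OF sqrt_at_top N_real])
  moreover have "\<forall>\<^sub>F j in sequentially. (real (M j) - lam * real (N j)) / sqrt (real (N j)) * inverse (sqrt (real (N j))) + lam
     = real (M j) / real (N j)"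
    using N_pos by eventually_elim (simp add: divide_inverse mult.assoc flip: inverse_mult_distrib, simp add: field_simps)
  ultimately show ?thesis by (rule Lim_transform_eventually[THEN tendsto_eq_rhs]) simp
qed

lemma M_real: "filterlim (\<lambda>j. real (M j)) at_top sequentially"
proof -
  have "filterlim (\<lambda>j. real (M j) / real (N j) * real (N j)) at_top sequentially"
    by (rule filterlim_tendsto_pos_mult_at_top[OF M_div_N lam_pos N_real])
  then show ?thesis
    by (rule filterlim_mono_eventually) (use N_pos in \<open>auto elim!: eventually_mono\<close>)
qed

lemma M_at_top: "filterlim M at_top sequentially"
  using M_real by (simp add: filterlim_sequentially_iff_filterlim_real)

text \<open>The normalising constant is the case of cutoff M with y = 0, because N T(M) = (N/M) * M
  T(M) -> (1 / lam) * 0.\<close>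

lemma partition_limit: "(\<lambda>j. sqrt (N j) * box_sum p (M j) (N j) (M j)) \<longlonglongrightarrow> 1 / sqrt (2 * pi * variance)"
proof -
  have "(\<lambda>j. inverse (real (M j) / real (N j)) * (real (M j) * tail p (M j))) \<longlonglongrightarrow> inverse lam * 0"
    using lam_pos by (intro tendsto_intros M_div_N filterlim_compose[OF mult_tail_tendsto_zero M_at_top]) auto
  moreover have "\<forall>\<^sub>F j in sequentially. inverse (real (M j) / real (N j)) * (real (M j) * tail p (M j)) = real (N j) * tail p (M j)"
    using eventually_compose_filterlim[OF eventually_gt_at_top[of 0] M_at_top]
    by eventually_elim (simp add: field_simps)
  ultimately have "(\<lambda>j. real (N j) * tail p (M j)) \<longlonglongrightarrow> 0"
    by (rule Lim_transform_eventually[THEN tendsto_eq_rhs]) simp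
  from local_limit[OF M_at_top N this M] show ?thesis by simp
qed

text \<open>Numerator and denominator share sqrt N and the Gaussian constant, so only exp(-y)
  remains.\<close>

lemma cdf_tendsto:
  assumes k: "filterlim k at_top sequentially"
    and T: "(\<lambda>j. real (N j) * tail p (k j)) \<longlonglongrightarrow> y"
  shows "(\<lambda>j. box_sum p (k j) (N j) (M j) / box_sum p (M j) (N j) (M j)) \<longlonglongrightarrow> exp (- y)"
proof -
  have "(\<lambda>j. (sqrt (N j) * box_sum p (k j) (N j) (M j)) / (sqrt (N j) * box_sum p (M j) (N j) (M j)))
      \<longlonglongrightarrow> (exp (- y) / sqrt (2 * pi * variance)) / (1 / sqrt (2 * pi * variance))"
    using variance_pos by (intro tendsto_divide local_limit[OF k N T M] partition_limit) auto
  moreover have "\<forall>\<^sub>F j in sequentially. (sqrt (N j) * box_sum p (k j) (N j) (M j)) / (sqrt (N j) * box_sum p (M j) (N j) (M j))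
      = box_sum p (k j) (N j) (M j) / box_sum p (M j) (N j) (M j)"
    using N_pos by eventually_elim simp
  ultimately show ?thesis by (rule Lim_transform_eventually[THEN tendsto_eq_rhs]) (use variance_pos in simp)
qed

lemma cdf_vanishes:
  assumes k: "filterlim k at_top sequentially"
    and T: "filterlim (\<lambda>j. real (N j) * tail p (k j)) at_top sequentially"
  shows "(\<lambda>j. box_sum p (k j) (N j) (M j) / box_sum p (M j) (N j) (M j)) \<longlonglongrightarrow> 0"
proof -
  have "(\<lambda>j. (sqrt (N j) * box_sum p (k j) (N j) (M j)) / (sqrt (N j) * box_sum p (M j) (N j) (M j)))
      \<longlonglongrightarrow> 0 / (1 / sqrt (2 * pi * variance))"
    using variance_pos by (intro tendsto_divide local_vanishing[OF k N T] partition_limit) auto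
  moreover have "\<forall>\<^sub>F j in sequentially. (sqrt (N j) * box_sum p (k j) (N j) (M j)) / (sqrt (N j) * box_sum p (M j) (N j) (M j))
      = box_sum p (k j) (N j) (M j) / box_sum p (M j) (N j) (M j)"
    using N_pos by eventually_elim simp
  ultimately show ?thesis by (rule Lim_transform_eventually[THEN tendsto_eq_rhs]) simp
qed

lemma Pmax_tendsto:
  assumes k: "filterlim k at_top sequentially"
    and a: "(\<lambda>j. box_sum p (k j) (N j) (M j) / box_sum p (M j) (N j) (M j)) \<longlonglongrightarrow> a"
    and b: "(\<lambda>j. box_sum p (k j - 1) (N j) (M j) / box_sum p (M j) (N j) (M j)) \<longlonglongrightarrow> b"
  shows "(\<lambda>j. Pmax p (M j) (N j) (k j)) \<longlonglongrightarrow> a - b"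
  using tendsto_diff[OF a b]
proof (rule Lim_transform_eventually)
  show "\<forall>\<^sub>F j in sequentially. box_sum p (k j) (N j) (M j) / box_sum p (M j) (N j) (M j) -
      box_sum p (k j - 1) (N j) (M j) / box_sum p (M j) (N j) (M j) = Pmax p (M j) (N j) (k j)"
    using N_pos eventually_compose_filterlim[OF eventually_gt_at_top[of 0] k]
    by eventually_elim (simp add: Pmax_eq_box_sum diff_divide_distrib)
qed

text \<open>T(k) = o(p_k), and T(k - 1) = p_k + T(k).\<close>

lemma scaled_tail_tendsto:
  assumes k: "filterlim k at_top sequentially"
    and x: "(\<lambda>j. real (N j) * p (k j)) \<longlonglongrightarrow> x"
  shows "(\<lambda>j. real (N j) * tail p (k j)) \<longlonglongrightarrow> 0"
    and "(\<lambda>j. real (N j) * tail p (k j - 1)) \<longlonglongrightarrow> x"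
proof -
  have "(\<lambda>j. (real (N j) * p (k j)) * (tail p (k j) / p (k j))) \<longlonglongrightarrow> x * 0"
    by (intro tendsto_mult x filterlim_compose[OF tail_div_tendsto_zero k])
  moreover have "\<forall>\<^sub>F j in sequentially. (real (N j) * p (k j)) * (tail p (k j) / p (k j)) = real (N j) * tail p (k j)"
    using eventually_compose_filterlim[OF p_eventually_pos k] by eventually_elim simp
  ultimately show *: "(\<lambda>j. real (N j) * tail p (k j)) \<longlonglongrightarrow> 0"
    by (rule Lim_transform_eventually[THEN tendsto_eq_rhs]) simp
  have "\<forall>\<^sub>F j in sequentially. real (N j) * p (k j) + real (N j) * tail p (k j) = real (N j) * tail p (k j - 1)"
    using eventually_compose_filterlim[OF eventually_gt_at_top[of 0] k]
    by eventually_elim (simp only: tail_pred distrib_left)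
  from tendsto_add[OF x *] this show "(\<lambda>j. real (N j) * tail p (k j - 1)) \<longlonglongrightarrow> x"
    by (rule Lim_transform_eventually[THEN tendsto_eq_rhs]) simp
qed

lemma scaled_tail_at_top:
  assumes k: "filterlim k at_top sequentially"
    and p_top: "filterlim (\<lambda>j. real (N j) * p (k j)) at_top sequentially"
  shows "filterlim (\<lambda>j. real (N j) * tail p (k j - 1)) at_top sequentially"
  using p_top
proof (rule filterlim_at_top_mono)
  show "\<forall>\<^sub>F j in sequentially. real (N j) * p (k j) \<le> real (N j) * tail p (k j - 1)"
    using eventually_compose_filterlim[OF eventually_gt_at_top[of 0] k]
    by eventually_elim (simp only: tail_pred distrib_left, simp add: tail_nonneg)
qed

text \<open>p_(k-1) is p_k divided by a ratio that tends to 0 through positive values.\<close>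

lemma scaled_p_pred_at_top:
  assumes k: "filterlim k at_top sequentially"
    and x: "(\<lambda>j. real (N j) * p (k j)) \<longlonglongrightarrow> x" "x > 0"
  shows "filterlim (\<lambda>j. real (N j) * p (k j - 1)) at_top sequentially"
proof -
  have pos: "\<forall>\<^sub>F k in sequentially. p (Suc k) / p k > 0"
    using p_eventually_pos eventually_sequentially_Suc[of "\<lambda>k. 0 < p k", THEN iffD2, OF p_eventually_pos]
    by eventually_elim simp
  have "filterlim (\<lambda>j. real (N j) * p (k j) * inverse (p (Suc (k j - 1)) / p (k j - 1))) at_top sequentially"
    by (intro filterlim_tendsto_pos_mult_at_top[OF x]
        filterlim_compose[OF filterlim_inverse_at_top[OF p_ratio pos] filterlim_diff_const_nat[OF k]])
  then show ?thesis
  proof (rule filterlim_mono_eventually[OF _ order_refl order_refl])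
    show "\<forall>\<^sub>F j in sequentially. real (N j) * p (k j) * inverse (p (Suc (k j - 1)) / p (k j - 1)) = real (N j) * p (k j - 1)"
      using eventually_compose_filterlim[OF eventually_gt_at_top[of 0] k]
        eventually_compose_filterlim[OF p_eventually_pos k]
      by eventually_elim simp
  qed
qed

text \<open>With n p_k -> x, the distribution function of the maximum tends to 1 at k, to exp(-x) at
  k - 1 and to 0 at k - 2; the two probabilities are its successive differences.\<close>

lemma Pmax_limit_critical:
  assumes lim: "(\<lambda>j. real (N j) / real (nat \<lfloor>1 / p (k j)\<rfloor>)) \<longlonglongrightarrow> x" and x: "x > 0"
  shows "filterlim k at_top sequentially"
    and "(\<lambda>j. Pmax p (M j) (N j) (k j - 1)) \<longlonglongrightarrow> exp (- x)"
    and "(\<lambda>j. Pmax p (M j) (N j) (k j)) \<longlonglongrightarrow> 1 - exp (- x)"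
proof -
  \<comment> \<open>As n / n_k -> x > 0, n_k is asymptotic to n / x, so n_k and with it k tend to
    infinity.\<close>
  have "filterlim (\<lambda>j. inverse (real (N j) / real (nat \<lfloor>1 / p (k j)\<rfloor>)) * real (N j)) at_top sequentially"
    using x by (intro filterlim_tendsto_pos_mult_at_top[OF tendsto_inverse[OF lim] _ N_real]) auto
  then have "filterlim (\<lambda>j. real (nat \<lfloor>1 / p (k j)\<rfloor>)) at_top sequentially"
    by (rule filterlim_mono_eventually[OF _ order_refl order_refl]) (use N_pos in \<open>auto elim!: eventually_mono\<close>)
  then have nk: "filterlim (\<lambda>j. nat \<lfloor>1 / p (k j)\<rfloor>) at_top sequentially"
    by (simp only: filterlim_sequentially_iff_filterlim_real)
  then show k: "filterlim k at_top sequentially"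
    by (rule filterlim_at_top_of_comp[where f = "\<lambda>k. nat \<lfloor>1 / p k\<rfloor>"])
  have "(\<lambda>j. real (N j) / real (nat \<lfloor>1 / p (k j)\<rfloor>) * (real (nat \<lfloor>1 / p (k j)\<rfloor>) * p (k j))) \<longlonglongrightarrow> x * 1"
    by (intro tendsto_mult lim filterlim_compose[OF floor_inverse_mult_tendsto k])
  moreover have "\<forall>\<^sub>F j in sequentially. real (N j) / real (nat \<lfloor>1 / p (k j)\<rfloor>) * (real (nat \<lfloor>1 / p (k j)\<rfloor>) * p (k j))
      = real (N j) * p (k j)"
    using eventually_compose_filterlim[OF eventually_gt_at_top[of 0] nk] by eventually_elim simp
  ultimately have Np: "(\<lambda>j. real (N j) * p (k j)) \<longlonglongrightarrow> x"
    by (rule Lim_transform_eventually[THEN tendsto_eq_rhs]) simp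
  note k' = filterlim_diff_const_nat[OF k]
  have c0: "(\<lambda>j. box_sum p (k j) (N j) (M j) / box_sum p (M j) (N j) (M j)) \<longlonglongrightarrow> exp (- 0)"
    by (rule cdf_tendsto[OF k scaled_tail_tendsto(1)[OF k Np]])
  have c1: "(\<lambda>j. box_sum p (k j - 1) (N j) (M j) / box_sum p (M j) (N j) (M j)) \<longlonglongrightarrow> exp (- x)"
    by (rule cdf_tendsto[OF k' scaled_tail_tendsto(2)[OF k Np]])
  from Pmax_tendsto[OF k c0 c1]
  show "(\<lambda>j. Pmax p (M j) (N j) (k j)) \<longlonglongrightarrow> 1 - exp (- x)" by simp
  have "(\<lambda>j. box_sum p (k j - 1 - 1) (N j) (M j) / box_sum p (M j) (N j) (M j)) \<longlonglongrightarrow> 0"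
    by (rule cdf_vanishes[OF filterlim_diff_const_nat[OF k']
          scaled_tail_at_top[OF k' scaled_p_pred_at_top[OF k Np x]]])
  from Pmax_tendsto[OF k' c1 this]
  show "(\<lambda>j. Pmax p (M j) (N j) (k j - 1)) \<longlonglongrightarrow> exp (- x)" by simp
qed

text \<open>Lying above n_k but outside its window means n > \<Omega>_k n_k, so n p_k -> infinity;
  lying below n_(k+1) but outside its window means n < n_(k+1) / \<Omega>_(k+1), so n p_(k+1) -> 0.
  The distribution function then jumps from 0 at k - 1 to 1 at k.\<close>

lemma Pmax_limit_separated:
  assumes \<Omega>: "filterlim \<Omega> at_top sequentially"
    and out: "\<And>j k. k \<ge> 1 \<Longrightarrow> \<not> (real (nat \<lfloor>1 / p k\<rfloor>) / \<Omega> k \<le> real (N j) \<and> real (N j) \<le> \<Omega> k * real (nat \<lfloor>1 / p k\<rfloor>))"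
    and btw: "\<And>j. nat \<lfloor>1 / p (k j)\<rfloor> < N j" "\<And>j. N j < nat \<lfloor>1 / p (Suc (k j))\<rfloor>"
  shows "filterlim k at_top sequentially"
    and "(\<lambda>j. Pmax p (M j) (N j) (k j)) \<longlonglongrightarrow> 1"
proof -
  have "filterlim (\<lambda>j. nat \<lfloor>1 / p (Suc (k j))\<rfloor>) at_top sequentially"
    by (rule filterlim_at_top_mono[OF N]) (intro always_eventually allI less_imp_le btw(2))
  then show k: "filterlim k at_top sequentially"
    by (rule filterlim_at_top_of_comp[where f = "\<lambda>k. nat \<lfloor>1 / p (Suc k)\<rfloor>"])
  then have Sk: "filterlim (\<lambda>j. Suc (k j)) at_top sequentially"
    by (rule filterlim_compose[OF filterlim_Suc])
  have "filterlim (\<lambda>j. (real (nat \<lfloor>1 / p (k j)\<rfloor>) * p (k j)) * \<Omega> (k j)) at_top sequentially"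
    by (rule filterlim_tendsto_pos_mult_at_top[OF filterlim_compose[OF floor_inverse_mult_tendsto k] _
          filterlim_compose[OF \<Omega> k]]) simp
  then have top: "filterlim (\<lambda>j. real (N j) * p (k j)) at_top sequentially"
  proof (rule filterlim_at_top_mono)
    show "\<forall>\<^sub>F j in sequentially. (real (nat \<lfloor>1 / p (k j)\<rfloor>) * p (k j)) * \<Omega> (k j) \<le> real (N j) * p (k j)"
      using eventually_compose_filterlim[OF eventually_ge_at_top[of 1] k]
        eventually_compose_filterlim[OF eventually_ge_at_top[of 1] filterlim_compose[OF \<Omega> k]]
    proof eventually_elim
      case (elim j)
      have "real (nat \<lfloor>1 / p (k j)\<rfloor>) / \<Omega> (k j) \<le> real (nat \<lfloor>1 / p (k j)\<rfloor>) / 1"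
        using elim by (intro divide_left_mono) auto
      also have "\<dots> \<le> real (N j)" using btw(1)[of j] by simp
      finally have "\<Omega> (k j) * real (nat \<lfloor>1 / p (k j)\<rfloor>) \<le> real (N j)"
        using out[OF elim(1), of j] by linarith
      from mult_right_mono[OF this p_nonneg[of "k j"]] show ?case by (simp add: mult_ac)
    qed
  qed
  have "(\<lambda>j. (real (nat \<lfloor>1 / p (Suc (k j))\<rfloor>) * p (Suc (k j))) * inverse (\<Omega> (Suc (k j)))) \<longlonglongrightarrow> 1 * 0"
    by (intro tendsto_mult filterlim_compose[OF floor_inverse_mult_tendsto Sk]
        tendsto_inverse_0_at_top filterlim_compose[OF \<Omega> Sk])
  then have bound: "(\<lambda>j. (real (nat \<lfloor>1 / p (Suc (k j))\<rfloor>) * p (Suc (k j))) * inverse (\<Omega> (Suc (k j)))) \<longlonglongrightarrow> 0"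
    by (simp only: mult_zero_right)
  have zero: "(\<lambda>j. real (N j) * p (Suc (k j))) \<longlonglongrightarrow> 0"
  proof (rule Lim_null_comparison[OF _ bound])
    show "\<forall>\<^sub>F j in sequentially. norm (real (N j) * p (Suc (k j))) \<le>
       (real (nat \<lfloor>1 / p (Suc (k j))\<rfloor>) * p (Suc (k j))) * inverse (\<Omega> (Suc (k j)))"
      using eventually_compose_filterlim[OF eventually_ge_at_top[of 1] filterlim_compose[OF \<Omega> Sk]]
    proof eventually_elim
      case (elim j)
      have "real (N j) \<le> 1 * real (nat \<lfloor>1 / p (Suc (k j))\<rfloor>)" using btw(2)[of j] by simp
      also have "\<dots> \<le> \<Omega> (Suc (k j)) * real (nat \<lfloor>1 / p (Suc (k j))\<rfloor>)"
        using elim by (intro mult_right_mono) auto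
      finally have "real (N j) \<le> real (nat \<lfloor>1 / p (Suc (k j))\<rfloor>) / \<Omega> (Suc (k j))"
        using out[of "Suc (k j)" j] by linarith
      from mult_right_mono[OF this p_nonneg[of "Suc (k j)"]] show ?case
        using p_nonneg by (simp add: divide_inverse mult_ac)
    qed
  qed
  \<comment> \<open>T(k) is the predecessor tail of index k + 1, asymptotic to p_(k+1).\<close>
  have "(\<lambda>j. real (N j) * tail p (k j)) \<longlonglongrightarrow> 0"
    using scaled_tail_tendsto(2)[OF Sk zero] by simp
  from Pmax_tendsto[OF k cdf_tendsto[OF k this]
      cdf_vanishes[OF filterlim_diff_const_nat[OF k] scaled_tail_at_top[OF k top]]]
  show "(\<lambda>j. Pmax p (M j) (N j) (k j)) \<longlonglongrightarrow> 1" by simp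
qed

end

end

section \<open>Reduction of the weights to a tilted probability distribution\<close>

text \<open>\<Phi> is entire: past some index each term is at most half its predecessor. The +1 in
  the threshold covers y = 0.\<close>

lemma summable_of_ratio_tendsto_zero:
  fixes w :: "nat \<Rightarrow> real"
  assumes wpos: "\<forall>\<^sub>F k in sequentially. w k > 0"
    and ratio: "(\<lambda>k. w (Suc k) / w k) \<longlonglongrightarrow> 0"
  shows "summable (\<lambda>k. w k * y ^ k)"
proof -
  have "\<forall>\<^sub>F k in sequentially. w (Suc k) / w k < 1 / (2 * (\<bar>y\<bar> + 1))"
    by (rule order_tendstoD(2)[OF ratio]) simp
  with wpos have "\<forall>\<^sub>F k in sequentially. w k > 0 \<and> w (Suc k) / w k < 1 / (2 * (\<bar>y\<bar> + 1))"
    by eventually_elim simp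
  then obtain K where K: "\<And>k. k \<ge> K \<Longrightarrow> w k > 0" "\<And>k. k \<ge> K \<Longrightarrow> w (Suc k) / w k < 1 / (2 * (\<bar>y\<bar> + 1))"
    by (auto simp: eventually_sequentially)
  show ?thesis
  proof (rule summable_ratio_test[of "1/2" K])
    fix n assume n: "n \<ge> K"
    have "w (Suc n) * \<bar>y\<bar> \<le> w (Suc n) * (\<bar>y\<bar> + 1)"
      using K(1)[of "Suc n"] n by (intro mult_left_mono) auto
    also have "\<dots> \<le> (1/2) * w n" using K(1,2)[OF n] by (simp add: field_simps)
    finally have "w (Suc n) * \<bar>y\<bar> \<le> (1/2) * w n" .
    from mult_right_mono[OF this, of "\<bar>y\<bar> ^ n"]
    show "norm (w (Suc n) * y ^ Suc n) \<le> 1/2 * norm (w n * y ^ n)"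
      using K(1)[OF n] K(1)[of "Suc n"] n by (simp add: abs_mult power_abs mult_ac)
  qed simp
qed

lemma Phi_pos:
  assumes "\<And>k. w k \<ge> 0" "w 0 > 0" "summable (\<lambda>k. w k * t ^ k)" "t > 0"
  shows "Phi w t > 0"
  unfolding Phi_def using assms by (intro suminf_pos2[where i = 0]) auto

text \<open>Termwise differentiation of the entire series identifies the mean of the tilted law as t
  \<Phi>'(t) / \<Phi>(t), and tilting merely multiplies the weight ratios by t.\<close>

lemma rapid_pmf_tilt:
  fixes w :: "nat \<Rightarrow> real"
  assumes nonneg: "\<And>k. w k \<ge> 0"
    and w0: "w 0 > 0"
    and wpos: "\<forall>\<^sub>F k in sequentially. w k > 0"
    and ratio: "(\<lambda>k. w (Suc k) / w k) \<longlonglongrightarrow> 0"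
    and t: "t > 0"
  shows "rapid_pmf (\<lambda>k. t ^ k * w k / Phi w t) (Psi w t)"
proof -
  note sm = summable_of_ratio_tendsto_zero[OF wpos ratio]
  have Phi: "Phi w t > 0" by (rule Phi_pos[OF nonneg w0 sm t])
  show ?thesis
  proof
    show "0 \<le> t ^ k * w k / Phi w t" for k using nonneg t Phi by simp
    have "(\<lambda>k. w k * t ^ k / Phi w t) sums (Phi w t / Phi w t)"
      unfolding Phi_def by (intro sums_divide summable_sums sm)
    then show "(\<lambda>k. t ^ k * w k / Phi w t) sums 1" using Phi by (simp add: mult_ac)
    have "(Phi w has_real_derivative (\<Sum>n. diffs w n * t ^ n)) (at t)"
      unfolding Phi_def[abs_def] by (rule termdiffs_strong_converges_everywhere[OF sm])
    then have deriv: "deriv (Phi w) t = (\<Sum>n. diffs w n * t ^ n)" by (rule DERIV_imp_deriv)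
    have "(\<lambda>n. diffs w n * t ^ n) sums deriv (Phi w) t"
      unfolding deriv by (intro summable_sums termdiff_converges_all sm)
    from sums_divide[OF sums_mult[OF this, of t], of "Phi w t"]
    have "(\<lambda>n. real (Suc n) * (t ^ Suc n * w (Suc n) / Phi w t)) sums Psi w t"
      by (simp add: Psi_def diffs_def mult_ac)
    \<comment> \<open>The derivative series starts at index 1; the missing term k = 0 of the mean is
      0.\<close>
    then show "(\<lambda>k. real k * (t ^ k * w k / Phi w t)) sums Psi w t"
      by (subst (asm) sums_Suc_iff) simp
    show "\<forall>\<^sub>F k in sequentially. 0 < t ^ k * w k / Phi w t"
      using wpos by eventually_elim (use t Phi in simp)
    have "(\<lambda>k. t * (w (Suc k) / w k)) \<longlonglongrightarrow> t * 0" by (intro tendsto_intros ratio)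
    then show "(\<lambda>k. (t ^ Suc k * w (Suc k) / Phi w t) / (t ^ k * w k / Phi w t)) \<longlonglongrightarrow> 0"
      using t Phi by simp
  qed
qed

theorem theorem18p23:
  fixes w :: "nat \<Rightarrow> real" and m :: "nat \<Rightarrow> nat" and lam \<tau> :: real
  assumes nonneg: "\<And>k. w k \<ge> 0"
    and w0: "w 0 > 0"
    and wpos: "\<forall>\<^sub>F k in sequentially. w k > 0"
    and ratio: "(\<lambda>k. w (Suc k) / w k) \<longlonglongrightarrow> 0"
    and lam: "0 < lam"
    and mlim: "(\<lambda>n. (real (m n) - lam * real n) / sqrt (real n)) \<longlonglongrightarrow> 0"
    and tau: "\<tau> > 0" "Psi w \<tau> = lam"
  defines "nk \<equiv> (\<lambda>k. nat \<lfloor>1 / (\<tau> ^ k * w k / Phi w \<tau>)\<rfloor>)"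
  shows
    "(\<forall>(s :: nat \<Rightarrow> nat) (kn :: nat \<Rightarrow> nat) (x :: real).
        strict_mono s \<and> 0 < x \<and> (\<lambda>j. real (s j) / real (nk (kn j))) \<longlonglongrightarrow> x \<longrightarrow>
          (\<lambda>j. Pmax w (m (s j)) (s j) (kn j - 1)) \<longlonglongrightarrow> exp (- x) \<and>
          (\<lambda>j. Pmax w (m (s j)) (s j) (kn j)) \<longlonglongrightarrow> 1 - exp (- x))
     \<and>
     (\<forall>(\<Omega> :: nat \<Rightarrow> real) (s :: nat \<Rightarrow> nat) (kn :: nat \<Rightarrow> nat).
        filterlim \<Omega> at_top sequentially \<and> strict_mono s \<and>
        (\<forall>j k. k \<ge> 1 \<longrightarrow> \<not> (real (nk k) / \<Omega> k \<le> real (s j) \<and> real (s j) \<le> \<Omega> k * real (nk k))) \<and>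
        (\<forall>j. nk (kn j) < s j \<and> s j < nk (Suc (kn j))) \<longrightarrow>
          (\<lambda>j. Pmax w (m (s j)) (s j) (kn j)) \<longlonglongrightarrow> 1)"
proof -
  define p where "p = (\<lambda>k. \<tau> ^ k * w k / Phi w \<tau>)"
  interpret rapid_pmf p lam
    unfolding p_def tau(2)[symmetric] by (rule rapid_pmf_tilt[OF nonneg w0 wpos ratio tau(1)])
  have Phi: "Phi w \<tau> \<noteq> 0"
    using Phi_pos[OF nonneg w0 summable_of_ratio_tendsto_zero[OF wpos ratio] tau(1)] by simp
  have nk: "nk k = nat \<lfloor>1 / p k\<rfloor>" for k by (simp add: nk_def p_def)
  \<comment> \<open>Tilting preserves the law of the maximum for positive n and k, hence eventually
    along the sequences, and this suffices for limits.\<close>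
  have transfer: "(\<lambda>j. Pmax w (m (s j)) (s j) (k j)) \<longlonglongrightarrow> a"
    if s: "filterlim s at_top sequentially" and k: "filterlim k at_top sequentially"
      and a: "(\<lambda>j. Pmax p (m (s j)) (s j) (k j)) \<longlonglongrightarrow> a" for s k :: "nat \<Rightarrow> nat" and a
    using a
  proof (rule Lim_transform_eventually)
    show "\<forall>\<^sub>F j in sequentially. Pmax p (m (s j)) (s j) (k j) = Pmax w (m (s j)) (s j) (k j)"
      using eventually_compose_filterlim[OF eventually_gt_at_top[of 0] s]
        eventually_compose_filterlim[OF eventually_gt_at_top[of 0] k]
      unfolding p_def by eventually_elim (rule Pmax_tilt, use tau(1) Phi in auto)
  qed
  show ?thesis
  proof (intro conjI allI impI; elim conjE)
    fix s kn :: "nat \<Rightarrow> nat" and x :: real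
    assume "strict_mono s" and x: "0 < x" and lim: "(\<lambda>j. real (s j) / real (nk (kn j))) \<longlonglongrightarrow> x"
    then have s: "filterlim s at_top sequentially" by (intro filterlim_subseq)
    note lims = Pmax_limit_critical[OF lam s filterlim_compose[OF mlim s] lim[unfolded nk] x]
    show "(\<lambda>j. Pmax w (m (s j)) (s j) (kn j - 1)) \<longlonglongrightarrow> exp (- x)"
      by (rule transfer[OF s filterlim_diff_const_nat[OF lims(1)] lims(2)])
    show "(\<lambda>j. Pmax w (m (s j)) (s j) (kn j)) \<longlonglongrightarrow> 1 - exp (- x)"
      by (rule transfer[OF s lims(1,3)])
  next
    fix \<Omega> :: "nat \<Rightarrow> real" and s kn :: "nat \<Rightarrow> nat"
    assume \<Omega>: "filterlim \<Omega> at_top sequentially" and "strict_mono s"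
      and out: "\<forall>j k. k \<ge> 1 \<longrightarrow> \<not> (real (nk k) / \<Omega> k \<le> real (s j) \<and> real (s j) \<le> \<Omega> k * real (nk k))"
      and btw: "\<forall>j. nk (kn j) < s j \<and> s j < nk (Suc (kn j))"
    then have s: "filterlim s at_top sequentially" by (intro filterlim_subseq)
    have "filterlim kn at_top sequentially" "(\<lambda>j. Pmax p (m (s j)) (s j) (kn j)) \<longlonglongrightarrow> 1"
      using Pmax_limit_separated[OF lam s filterlim_compose[OF mlim s] \<Omega>, of kn] out btw
      unfolding nk by blast+
    then show "(\<lambda>j. Pmax w (m (s j)) (s j) (kn j)) \<longlonglongrightarrow> 1"
      by (rule transfer[OF s])
  qed
qed

end
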